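(* Let $k$ be an algebraically closed field of characteristic zero, $n>1$ and $\mathbf{x}=(x_1,\dots,x_n)$. The field $k((\mathbf{x}))^{*}$ is algebraically closed.
   Context: For $1\le i<j\le n$, the order-preserving monomial blowing-up $\varphi_{ij}$ is the linear automorphism of $\mathbb{R}^n$ which replaces the $j$-th coordinate $a_j$ of $(a_1,\dots,a_n)$ by $a_i+a_j$ and leaves the other coordinates unchanged; its inverse is an order-preserving monomial blowing-down. $\mathcal{S}$ is the set of finite compositions of order-preserving monomial blowing-downs of $\mathbb{R}^n$ and $\Lambda=\{\Phi(\mathbb{R}_{\ge0}^n):\Phi\in\mathcal{S}\}$. $K_{n,d}=k((x_n^{1/d}))\cdots((x_1^{1/d}))$ is the field of iterated formal Laurent series ($K_{1,d}=k((x_1^{1/d}))$, and $K_{n,d}=L((x_1^{1/d}))$ with $L=k((x_n^{1/d}))\cdots((x_2^{1/d}))$), whose elements are regarded as formal sums $f=\sum_{\mathbf{a}\in\mathbb{Z}^n}f_{\mathbf{a}}\mathbf{x}^{\mathbf{a}/d}$, $f_{\mathbf{a}}\in k$, with Newton diagram $\mathcal{E}(f)=\{\mathbf{a}/d: f_{\mathbf{a}}\neq0\}$; when $d\mid d'$, $K_{n,d}\subset K_{n,d'}$ in the obvious way. For $\Gamma\in\Lambda$ and $d\in\mathbb{Z}_{>0}$, $k[[\Gamma,d]]$ is the subring of $K_{n,d}$ consisting of the series $f$ with $\mathcal{E}(f)\subset\Gamma$. These rings form a direct system under inclusion; $k[[\mathbf{x}]]^{*}=\bigcup_{(\Gamma,d)\in\Lambda\times\mathbb{Z}_{>0}}k[[\Gamma,d]]$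 and $k((\mathbf{x}))^{*}=\bigcup_{(\Gamma,d)\in\Lambda\times\mathbb{Z}_{>0}}Q(k[[\Gamma,d]])$, where $Q(-)$ denotes quotient field. $k((\mathbf{x}))^{*}$ is the quotient field of $k[[\mathbf{x}]]^{*}$. *)

theory Defs
  imports
    Complex_Main
    "HOL-Computational_Algebra.Polynomial"
    "HOL-Algebra.Algebraic_Closure"
begin

text \<open>
  An \<open>n\<close>-tuple is a function on \<^typ>\<open>nat\<close> that vanishes from \<open>n\<close> on, with entry \<open>i\<close> standing for
  the coordinate (variable) number \<open>i + 1\<close>.
\<close>

section \<open>Monomial blowing-ups, blowing-downs and the cones they generate\<close>

definition blow_up :: "nat \<Rightarrow> nat \<Rightarrow> (nat \<Rightarrow> real) \<Rightarrow> nat \<Rightarrow> real" where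
  "blow_up i j a = a(j := a i + a j)"

definition blow_down :: "nat \<Rightarrow> nat \<Rightarrow> (nat \<Rightarrow> real) \<Rightarrow> nat \<Rightarrow> real" where
  "blow_down i j a = a(j := a j - a i)"

lemma blow_down_is_inverse:
  assumes "i < j"
  shows "blow_down i j (blow_up i j a) = a" "blow_up i j (blow_down i j a) = a"
  using assms by (auto simp: blow_up_def blow_down_def)

inductive_set blow_downs :: "nat \<Rightarrow> ((nat \<Rightarrow> real) \<Rightarrow> nat \<Rightarrow> real) set" for n :: nat where
  empty: "id \<in> blow_downs n"
| comp: "\<Phi> \<in> blow_downs n \<Longrightarrow> i < j \<Longrightarrow> j < n \<Longrightarrow> blow_down i j \<circ> \<Phi> \<in> blow_downs n"

definition orthant :: "nat \<Rightarrow> (nat \<Rightarrow> real) set" where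
  "orthant n = {a. (\<forall>i<n. 0 \<le> a i) \<and> (\<forall>i\<ge>n. a i = 0)}"

definition cones :: "nat \<Rightarrow> (nat \<Rightarrow> real) set set" where
  "cones n = {\<Phi> ` orthant n | \<Phi>. \<Phi> \<in> blow_downs n}"

section \<open>Iterated Laurent series\<close>

text \<open>
  A formal sum is represented by its coefficient function on rational exponent tuples, that is,
  \<open>f a\<close> is the coefficient of \<open>x\<^sup>a\<close> (so exponents are already divided by \<open>d\<close>, and the inclusions
  for \<open>d dvd d'\<close> are literal ones).  The recursion is \<open>K\<^sub>n = L((x\<^sub>1\<^sup>1\<^sup>/\<^sup>d))\<close> with \<open>L\<close> the
  field of series in the remaining \<open>n - 1\<close> variables: \<^term>\<open>\<lambda>a. f (case_nat r a)\<close> is the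
  coefficient in \<open>L\<close> of the \<open>r\<close>-th power of the first variable.  For \<open>n = 0\<close> only the constants
  of \<open>k\<close> remain.
\<close>

primrec iterated_laurent :: "nat \<Rightarrow> nat \<Rightarrow> ((nat \<Rightarrow> rat) \<Rightarrow> 'k::field) set" where
  "iterated_laurent 0 d = {f. \<forall>a. f a \<noteq> 0 \<longrightarrow> a = (\<lambda>_. 0)}"
| "iterated_laurent (Suc n) d =
    {f. (\<forall>r. (\<lambda>a. f (case_nat r a)) \<in> iterated_laurent n d) \<and>
        (\<forall>r a. f (case_nat r a) \<noteq> 0 \<longrightarrow> of_nat d * r \<in> \<int>) \<and>
        (\<exists>N. \<forall>r a. f (case_nat r a) \<noteq> 0 \<longrightarrow> N \<le> r)}"

definition series_mult ::
  "((nat \<Rightarrow> rat) \<Rightarrow> 'k::field) \<Rightarrow> ((nat \<Rightarrow> rat) \<Rightarrow> 'k) \<Rightarrow> (nat \<Rightarrow> rat) \<Rightarrow> 'k" where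
  "series_mult f g c =
    (\<Sum>a | f a \<noteq> 0 \<and> g (\<lambda>i. c i - a i) \<noteq> 0. f a * g (\<lambda>i. c i - a i))"

text \<open>The sum in \<^const>\<open>series_mult\<close> is always finite on iterated Laurent series.\<close>

lemma finite_bounded_multiples:
  assumes "0 < d"
  shows "finite {r::rat. of_nat d * r \<in> \<int> \<and> M \<le> r \<and> r \<le> N}"
proof (rule finite_subset)
  show "{r::rat. of_nat d * r \<in> \<int> \<and> M \<le> r \<and> r \<le> N}
      \<subseteq> (\<lambda>z. of_int z / of_nat d) ` {\<lfloor>of_nat d * M\<rfloor>..\<lceil>of_nat d * N\<rceil>}"
  proof
    fix r :: rat
    assume r: "r \<in> {r. of_nat d * r \<in> \<int> \<and> M \<le> r \<and> r \<le> N}"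
    then obtain z where z: "of_nat d * r = of_int z"
      by (auto elim: Ints_cases)
    have "of_nat d * M \<le> of_int z" "of_int z \<le> of_nat d * N"
      using r by (auto simp flip: z intro: mult_left_mono)
    hence "\<lfloor>of_nat d * M\<rfloor> \<le> z" "z \<le> \<lceil>of_nat d * N\<rceil>"
      by linarith+
    moreover have "r = of_int z / of_nat d"
      using z assms by (simp add: field_simps)
    ultimately show "r \<in> (\<lambda>z. of_int z / of_nat d) ` {\<lfloor>of_nat d * M\<rfloor>..\<lceil>of_nat d * N\<rceil>}"
      by auto
  qed
qed auto

lemma finite_series_mult_support:
  assumes "0 < d" "f \<in> iterated_laurent n d" "g \<in> iterated_laurent n d"
  shows "finite {a. f a \<noteq> 0 \<and> g (\<lambda>i. c i - a i) \<noteq> 0}"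
  using assms(2,3)
proof (induction n arbitrary: f g c)
  case 0
  have "{a. f a \<noteq> 0 \<and> g (\<lambda>i. c i - a i) \<noteq> 0} \<subseteq> {\<lambda>_. 0}"
    using 0 by auto
  thus ?case
    using finite_subset by blast
next
  case (Suc n)
  obtain M where M: "\<And>r a. f (case_nat r a) \<noteq> 0 \<Longrightarrow> M \<le> r"
    using Suc.prems by simp blast
  obtain N where N: "\<And>r a. g (case_nat r a) \<noteq> 0 \<Longrightarrow> N \<le> r"
    using Suc.prems by simp blast
  define R where "R = {r. of_nat d * r \<in> \<int> \<and> M \<le> r \<and> r \<le> c 0 - N}"
  define S where "S r = {b. f (case_nat r b) \<noteq> 0 \<and>
    g (case_nat (c 0 - r) (\<lambda>i. c (Suc i) - b i)) \<noteq> 0}" for r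
  have "finite R"
    unfolding R_def using assms(1) by (rule finite_bounded_multiples)
  moreover have "finite (S r)" for r
    unfolding S_def
    using Suc.IH[of "\<lambda>a. f (case_nat r a)" "\<lambda>a. g (case_nat (c 0 - r) a)" "\<lambda>i. c (Suc i)"]
      Suc.prems by simp
  ultimately have "finite (\<Union>r\<in>R. case_nat r ` S r)"
    by blast
  moreover have "{a. f a \<noteq> 0 \<and> g (\<lambda>i. c i - a i) \<noteq> 0} \<subseteq> (\<Union>r\<in>R. case_nat r ` S r)"
  proof
    fix a
    assume a: "a \<in> {a. f a \<noteq> 0 \<and> g (\<lambda>i. c i - a i) \<noteq> 0}"
    define b where "b = (\<lambda>i. a (Suc i))"
    have ab: "a = case_nat (a 0) b"
      by (auto simp: b_def fun_eq_iff split: nat.split)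
    have cab: "(\<lambda>i. c i - a i) = case_nat (c 0 - a 0) (\<lambda>i. c (Suc i) - b i)"
      by (auto simp: b_def fun_eq_iff split: nat.split)
    have f: "f (case_nat (a 0) b) \<noteq> 0"
      using a ab by auto
    have g: "g (case_nat (c 0 - a 0) (\<lambda>i. c (Suc i) - b i)) \<noteq> 0"
      using a cab by auto
    have "of_nat d * a 0 \<in> \<int>"
      using Suc.prems(1) f by auto
    hence "a 0 \<in> R"
      using M[OF f] N[OF g] by (auto simp: R_def)
    moreover have "b \<in> S (a 0)"
      using f g by (simp add: S_def)
    ultimately show "a \<in> (\<Union>r\<in>R. case_nat r ` S r)"
      using ab by blast
  qed
  ultimately show ?case
    using finite_subset by blast
qed

definition series_ring ::
  "((nat \<Rightarrow> rat) \<Rightarrow> 'k::field) set \<Rightarrow> ((nat \<Rightarrow> rat) \<Rightarrow> 'k) ring" where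
  "series_ring A = \<lparr>
    carrier = A,
    monoid.mult = series_mult,
    one = (\<lambda>a. if a = (\<lambda>_. 0) then 1 else 0),
    ring.zero = (\<lambda>_. 0),
    add = (\<lambda>f g a. f a + g a)\<rparr>"

abbreviation laurent_field :: "nat \<Rightarrow> nat \<Rightarrow> ((nat \<Rightarrow> rat) \<Rightarrow> 'k::field) ring" where
  "laurent_field n d \<equiv> series_ring (iterated_laurent n d)"

definition newton_diagram :: "((nat \<Rightarrow> rat) \<Rightarrow> 'k::field) \<Rightarrow> (nat \<Rightarrow> real) set" where
  "newton_diagram f = (\<lambda>a i. of_rat (a i)) ` {a. f a \<noteq> 0}"

section \<open>The ring $k[[\Gamma,d]]$ and the field $k((\mathbf{x}))^{*}$\<close>

definition cone_series ::
  "nat \<Rightarrow> (nat \<Rightarrow> real) set \<Rightarrow> nat \<Rightarrow> ((nat \<Rightarrow> rat) \<Rightarrow> 'k::field) set" where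
  "cone_series n \<Gamma> d = {f \<in> iterated_laurent n d. newton_diagram f \<subseteq> \<Gamma>}"

text \<open>The quotient field of a subring \<open>R\<close> of the field \<open>K\<close>, realised inside \<open>K\<close>.\<close>

definition quotient_field_in :: "'a ring \<Rightarrow> 'a set \<Rightarrow> 'a set" where
  "quotient_field_in K R =
    {f \<otimes>\<^bsub>K\<^esub> inv\<^bsub>K\<^esub> g | f g. f \<in> R \<and> g \<in> R \<and> g \<noteq> \<zero>\<^bsub>K\<^esub>}"

definition cone_fraction_field :: "nat \<Rightarrow> ((nat \<Rightarrow> rat) \<Rightarrow> 'k::field) ring" where
  "cone_fraction_field n = series_ring
    (\<Union>\<Gamma>\<in>cones n. \<Union>d\<in>{0<..}. quotient_field_in (laurent_field n d) (cone_series n \<Gamma> d))"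

end

theory Submission
  imports
    Defs
    "HOL-Library.Function_Algebras"
    "HOL-Library.Set_Algebras"
begin

text \<open>
  The field in question consists of the series whose exponents lie in some \<open>(1/d) \<int>\<^sup>n\<close> and in a
  translate of some cone in \<open>\<Lambda>\<close> (lemma \<open>cone_fraction_field_eq\<close>).  It carries the valuation
  that sends a series to its lexicographically least exponent.  The value group is \<open>\<rat>\<^sup>n\<close>, hence
  divisible, and the residue field is \<open>k\<close>.

  The decisive point is what the valuation ring looks like.  The cones in \<open>\<Lambda>\<close> are cofinal with a
  single increasing chain: the \<open>N\<close>-th cone consists of the vectors whose \<open>N\<close>-fold prefix sums are
  nonnegative.  If a vector is lexicographically positive, its first nonzero entry is added over and
  over to the later ones, so that the prefix sums become nonnegative in the end; on a lattice and for
  entries bounded below, the number of steps is uniform (lemma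
  \<open>lex_nonneg_shifted_cone_in_cone\<close>).  Therefore a series of nonnegative value already lies in one of
  the rings \<open>k[[\<Gamma>,d]]\<close>, which are rings of formal power series in \<open>n\<close> variables because \<open>\<Gamma>\<close>
  is unimodular.  In such a ring equations can be solved coefficient by coefficient, by recursion on
  the total degree.  This yields inverses of series with constant term 1 (lemma
  \<open>cone_unit_inverse\<close>) and the lifting of coprime factorizations (lemma
  \<open>hensel_factorization\<close>).

  With Hensel's lemma, every monic polynomial of positive degree \<open>m\<close> has a root by induction on
  \<open>m\<close> (lemma \<open>monic_has_root\<close>).  A shift of the variable makes the second coefficient vanish; if no
  lower coefficient is left, \<open>0\<close> is a root.  Otherwise a substitution \<open>T \<mapsto> x\<^sup>\<gamma> T\<close>, with \<open>\<gamma>\<close>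
  read off from the Newton polygon, makes all coefficients lie in the valuation ring and at least one
  below the leading one a unit.  The residue polynomial over \<open>k\<close> is monic of degree \<open>m\<close>, differs
  from \<open>T\<^sup>m\<close> and has vanishing second coefficient; in characteristic zero it is therefore not a power
  of a linear polynomial, so it is a product of two coprime factors of lower degree.  The lifted
  factors have lower degree than \<open>m\<close>, and the induction hypothesis applies to one of them.
\<close>

section \<open>Iterated prefix sums\<close>

text \<open>
  On the first \<open>n\<close> coordinates, taking prefix sums is the composition of the blow-ups for the pairs
  \<open>(0,1)\<close>, \<open>(1,2)\<close>, ..., \<open>(n-2,n-1)\<close>, in this order.  Its iterates are cofinal among all
  compositions of blow-ups, so that one number takes the place of a word in the blow-ups.
\<close>

definition prefix_sum :: "(nat \<Rightarrow> 'a::comm_monoid_add) \<Rightarrow> nat \<Rightarrow> 'a" where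
  "prefix_sum a i = (\<Sum>l\<le>i. a l)"

lemma prefix_sum_eq: "prefix_sum a i = a i + (\<Sum>l<i. a l)"
  by (simp add: prefix_sum_def lessThan_Suc_atMost [symmetric] add.commute)

lemma prefix_sum_pow_add: "(prefix_sum ^^ N) (a + b) = (prefix_sum ^^ N) a + (prefix_sum ^^ N) b"
proof (induction N)
  case (Suc N)
  thus ?case
    by (simp add: fun_eq_iff prefix_sum_def sum.distrib)
qed simp

lemma prefix_sum_pow_uminus:
  fixes a :: "nat \<Rightarrow> 'a::ab_group_add"
  shows "(prefix_sum ^^ N) (- a) = - (prefix_sum ^^ N) a"
  by (induction N) (simp_all add: fun_eq_iff prefix_sum_def sum_negf)

lemma prefix_sum_pow_diff:
  fixes a :: "nat \<Rightarrow> 'a::ab_group_add"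
  shows "(prefix_sum ^^ N) (a - b) = (prefix_sum ^^ N) a - (prefix_sum ^^ N) b"
  using prefix_sum_pow_add [of N a "- b"] by (simp add: prefix_sum_pow_uminus)

lemma prefix_sum_pow_zero: "(prefix_sum ^^ N) 0 = 0"
  by (induction N) (simp_all add: fun_eq_iff prefix_sum_def)

lemma prefix_sum_pow_eq_0_iff:
  fixes a :: "nat \<Rightarrow> 'a::ab_group_add"
  shows "(\<forall>i<n. (prefix_sum ^^ N) a i = 0) \<longleftrightarrow> (\<forall>i<n. a i = 0)"
proof (induction N)
  case (Suc N)
  have *: "(\<forall>i<n. prefix_sum b i = 0) \<longleftrightarrow> (\<forall>i<n. b i = 0)" for b :: "nat \<Rightarrow> 'a"
  proof (induction n)
    case (Suc n)
    have "prefix_sum b n = b n" if "\<forall>i<n. b i = 0"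
      using that by (simp add: prefix_sum_eq)
    with Suc show ?case
      by (auto simp: less_Suc_eq)
  qed simp
  show ?case
    using * [of "(prefix_sum ^^ N) a"] Suc by simp
qed simp

lemma prefix_sum_pow_nonneg:
  fixes a :: "nat \<Rightarrow> 'a::ordered_comm_monoid_add"
  assumes "N \<le> M" "\<forall>i<n. 0 \<le> (prefix_sum ^^ N) a i" "i < n"
  shows "0 \<le> (prefix_sum ^^ M) a i"
  using assms(1,3)
proof (induction M arbitrary: i rule: dec_induct)
  case base
  thus ?case using assms(2) by simp
next
  case (step m)
  thus ?case
    by (auto simp: prefix_sum_def intro!: sum_nonneg)
qed

text \<open>
  How far \<open>b\<close> may fall below a nonnegative vector \<open>a\<close>: each entry only by a multiple of the sum
  of the earlier entries of \<open>a\<close>.  The image \<open>b = \<Phi> a\<close> of a point \<open>a\<close> of the orthant under a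
  composition of blow-downs is of this kind, and so is a lexicographically nonnegative lattice vector
  \<open>b\<close> with bounded negative part, with \<open>a\<close> its positive part.
\<close>

definition dominates :: "nat \<Rightarrow> 'a::linordered_field \<Rightarrow> (nat \<Rightarrow> 'a) \<Rightarrow> (nat \<Rightarrow> 'a) \<Rightarrow> bool" where
  "dominates n C a b \<longleftrightarrow> (\<forall>i<n. 0 \<le> a i \<and> a i - C * (\<Sum>l<i. a l) \<le> b i)"

lemma dominates_prefix_sum:
  assumes "0 \<le> C" "dominates n C a b"
  shows "dominates n (C * (1 + of_nat n)) a (prefix_sum b)"
  unfolding dominates_def
proof (intro allI impI conjI)
  fix i assume i: "i < n"
  show "0 \<le> a i"
    using assms i by (simp add: dominates_def)
  define S where "S = (\<Sum>l<i. a l)"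
  have nn: "0 \<le> a l" if "l < n" for l
    using assms that by (simp add: dominates_def)
  have S: "0 \<le> S"
    using nn i by (auto simp: S_def intro!: sum_nonneg)
  have "- (C * S) \<le> b l" if "l < i" for l
  proof -
    have "(\<Sum>l<l. a l) \<le> S"
      unfolding S_def using that i nn by (intro sum_mono2) auto
    hence "C * (\<Sum>l<l. a l) \<le> C * S"
      using assms(1) by (rule mult_left_mono)
    moreover have "0 \<le> a l" "a l - C * (\<Sum>l<l. a l) \<le> b l"
      using assms that i by (auto simp: dominates_def)
    ultimately show ?thesis by linarith
  qed
  hence "(\<Sum>l<i. - (C * S)) \<le> (\<Sum>l<i. b l)"
    by (intro sum_mono) auto
  hence 1: "- (of_nat i * (C * S)) \<le> (\<Sum>l<i. b l)"
    by (simp add: sum_negf)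
  have 2: "of_nat i * (C * S) \<le> of_nat n * (C * S)"
    using i S assms(1) by (intro mult_right_mono) auto
  have 3: "a i - C * S \<le> b i"
    using assms i by (simp add: dominates_def S_def)
  have "a i - C * (1 + of_nat n) * S = a i - C * S - of_nat n * (C * S)"
    by (simp add: algebra_simps)
  also have "\<dots> \<le> prefix_sum b i"
    using 1 2 3 by (simp add: prefix_sum_eq)
  finally show "a i - C * (1 + of_nat n) * (\<Sum>l<i. a l) \<le> prefix_sum b i"
    by (simp add: S_def)
qed

lemma dominates_prefix_sum_pow:
  fixes C :: "'a::linordered_field"
  assumes "0 \<le> C"
  shows "\<exists>C'\<ge>0. \<forall>a b. dominates n C a b \<longrightarrow> dominates n C' a ((prefix_sum ^^ N) b)"
proof (induction N)
  case 0
  thus ?case using assms by auto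
next
  case (Suc N)
  then obtain C' where C': "0 \<le> C'" "\<And>a b. dominates n C a b \<Longrightarrow> dominates n C' a ((prefix_sum ^^ N) b)"
    by blast
  show ?case
    using C' dominates_prefix_sum [of C' n]
    by (intro exI [of _ "C' * (1 + of_nat n)"]) auto
qed

text \<open>
  By induction on the number \<open>j\<close> of entries under control.  Once the entries before \<open>j\<close> are at
  least the partial sums of \<open>a\<close>, each further step adds at least \<open>S = (\<Sum>l<j. a l)\<close> to entry
  \<open>j\<close>, while the deficit of this entry is at most \<open>C' S\<close> with \<open>C'\<close> independent of \<open>a\<close> and
  \<open>b\<close>; so \<open>C' + 1\<close> steps are enough.  The bound by partial sums instead of \<open>0\<close> is what makes the
  gain per step proportional to \<open>S\<close>.
\<close>

lemma prefix_sum_pow_ge_partial_sums: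
  fixes C :: "'a::archimedean_field"
  assumes C: "0 \<le> C" and "j \<le> n"
  shows "\<exists>N. \<forall>a b. dominates n C a b \<longrightarrow> (\<forall>i<j. (\<Sum>l\<le>i. a l) \<le> (prefix_sum ^^ N) b i)"
  using assms(2)
proof (induction j)
  case (Suc j)
  then obtain N where N: "\<And>a b i. dominates n C a b \<Longrightarrow> i < j \<Longrightarrow> (\<Sum>l\<le>i. a l) \<le> (prefix_sum ^^ N) b i"
    by auto
  obtain C' where C': "\<And>a b. dominates n C a b \<Longrightarrow> dominates n C' a ((prefix_sum ^^ N) b)"
    using dominates_prefix_sum_pow [OF C] by blast
  obtain K where K: "C' + 1 \<le> of_nat K"
    using real_arch_simple by blast
  have "(\<Sum>l\<le>i. a l) \<le> (prefix_sum ^^ (K + N)) b i" if ab: "dominates n C a b" and "i < Suc j" for a b i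
  proof -
    define S where "S = (\<Sum>l<j. a l)"
    have nn: "0 \<le> a l" if "l < n" for l
      using ab that by (simp add: dominates_def)
    have S: "0 \<le> S"
      using nn Suc.prems by (auto simp: S_def intro!: sum_nonneg)
    have *: "(\<forall>i<j. (\<Sum>l\<le>i. a l) \<le> (prefix_sum ^^ (K + N)) b i) \<and>
        a j - C' * S + of_nat K * S \<le> (prefix_sum ^^ (K + N)) b j" for K
    proof (induction K)
      case 0
      have "a j - C' * S \<le> (prefix_sum ^^ N) b j"
        using C' [OF ab] Suc.prems by (simp add: dominates_def S_def)
      thus ?case
        using N [OF ab] by simp
    next
      case (Suc K)
      let ?x = "(prefix_sum ^^ (K + N)) b"
      have x: "a i \<le> ?x i" if "i < j" for i
      proof -
        have "a i \<le> (\<Sum>l\<le>i. a l)"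
          using nn that \<open>Suc j \<le> n\<close> by (intro member_le_sum) auto
        thus ?thesis
          using Suc that by force
      qed
      have "(\<Sum>l\<le>i. a l) \<le> prefix_sum ?x i" if "i < j" for i
      proof -
        have "0 \<le> (\<Sum>l<i. ?x l)"
          using nn x that \<open>Suc j \<le> n\<close> by (intro sum_nonneg) (meson lessThan_iff less_trans order_trans Suc_le_lessD)
        moreover have "(\<Sum>l\<le>i. a l) \<le> ?x i"
          using Suc that by blast
        ultimately show ?thesis
          by (simp add: prefix_sum_eq)
      qed
      moreover have "S \<le> (\<Sum>l<j. ?x l)"
        unfolding S_def using x by (intro sum_mono) auto
      moreover have "prefix_sum ?x j = ?x j + (\<Sum>l<j. ?x l)"
        by (rule prefix_sum_eq)
      ultimately show ?case
        using Suc by (auto simp: algebra_simps)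
    qed
    have "S * (C' + 1) \<le> S * of_nat K"
      using K S by (rule mult_left_mono)
    hence "a j + S \<le> (prefix_sum ^^ (K + N)) b j"
      using * [of K] by (simp add: algebra_simps)
    moreover have "(\<Sum>l\<le>j. a l) = a j + S"
      by (simp add: S_def lessThan_Suc_atMost [symmetric] add.commute)
    ultimately show ?thesis
      using * [of K] \<open>i < Suc j\<close> by (auto simp: less_Suc_eq)
  qed
  thus ?case by blast
qed auto

lemma prefix_sum_pow_eventually_nonneg:
  fixes C :: "'a::archimedean_field"
  assumes C: "0 \<le> C"
  shows "\<exists>N. \<forall>a b. dominates n C a b \<longrightarrow> (\<forall>i<n. 0 \<le> (prefix_sum ^^ N) b i)"
proof -
  obtain N where N: "\<And>a b i. dominates n C a b \<Longrightarrow> i < n \<Longrightarrow> (\<Sum>l\<le>i. a l) \<le> (prefix_sum ^^ N) b i"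
    using prefix_sum_pow_ge_partial_sums [OF C order.refl] by blast
  have "0 \<le> (prefix_sum ^^ N) b i" if "dominates n C a b" "i < n" for a b i
  proof -
    have "0 \<le> (\<Sum>l\<le>i. a l)"
      using that by (auto simp: dominates_def intro!: sum_nonneg)
    thus ?thesis
      using N [OF that] by linarith
  qed
  thus ?thesis by blast
qed

section \<open>Supports of iterated Laurent series\<close>

text \<open>
  Being an iterated Laurent series is a property of the support alone.  In terms of supports, sums and
  products of series become unions and sumsets.
\<close>

primrec laurent_supports :: "nat \<Rightarrow> nat \<Rightarrow> (nat \<Rightarrow> rat) set set" where
  "laurent_supports 0 d = Pow {0}"
| "laurent_supports (Suc n) d = {A. (\<forall>r. {a. case_nat r a \<in> A} \<in> laurent_supports n d) \<and>
    (\<forall>r a. case_nat r a \<in> A \<longrightarrow> of_nat d * r \<in> \<int>) \<and> (\<exists>N. \<forall>r a. case_nat r a \<in> A \<longrightarrow> N \<le> r)}"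

lemma iterated_laurent_iff: "f \<in> iterated_laurent n d \<longleftrightarrow> {a. f a \<noteq> 0} \<in> laurent_supports n d"
proof (induction n arbitrary: f)
  case 0
  show ?case
    by (auto simp: zero_fun_def)
next
  case (Suc n)
  show ?case
    unfolding iterated_laurent.simps laurent_supports.simps mem_Collect_eq Suc.IH ..
qed

lemma laurent_supports_subset: "A \<in> laurent_supports n d \<Longrightarrow> B \<subseteq> A \<Longrightarrow> B \<in> laurent_supports n d"
proof (induction n arbitrary: A B)
  case (Suc n)
  have "{a. case_nat r a \<in> B} \<in> laurent_supports n d" for r
  proof (rule Suc.IH)
    show "{a. case_nat r a \<in> A} \<in> laurent_supports n d"
      using Suc.prems by simp
  qed (use Suc.prems in blast)
  moreover have "\<exists>N. \<forall>r a. case_nat r a \<in> B \<longrightarrow> N \<le> r"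
    using Suc.prems by simp blast
  moreover have "of_nat d * r \<in> \<int>" if "case_nat r a \<in> B" for r a
    using Suc.prems that by (simp, blast)
  ultimately show ?case
    unfolding laurent_supports.simps by blast
qed auto

lemma laurent_supports_empty: "{} \<in> laurent_supports n d"
  by (induction n) auto

lemma laurent_supports_Un:
  "A \<in> laurent_supports n d \<Longrightarrow> B \<in> laurent_supports n d \<Longrightarrow> A \<union> B \<in> laurent_supports n d"
proof (induction n arbitrary: A B)
  case (Suc n)
  obtain M where M: "\<And>r a. case_nat r a \<in> A \<Longrightarrow> M \<le> r"
    using Suc.prems by simp blast
  obtain N where N: "\<And>r a. case_nat r a \<in> B \<Longrightarrow> N \<le> r"
    using Suc.prems by simp blast
  have "{a. case_nat r a \<in> A \<union> B} \<in> laurent_supports n d" for r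
  proof -
    have "{a. case_nat r a \<in> A} \<union> {a. case_nat r a \<in> B} \<in> laurent_supports n d"
      using Suc by auto
    moreover have "{a. case_nat r a \<in> A \<union> B} = {a. case_nat r a \<in> A} \<union> {a. case_nat r a \<in> B}"
      by auto
    ultimately show ?thesis
      by metis
  qed
  moreover have "of_nat d * r \<in> \<int>" if "case_nat r a \<in> A \<union> B" for r a
    using that Suc.prems by auto
  moreover have "\<forall>r a. case_nat r a \<in> A \<union> B \<longrightarrow> min M N \<le> r"
    using M N by (auto simp: min_le_iff_disj)
  ultimately show ?case
    unfolding laurent_supports.simps by blast
qed auto

lemma laurent_supports_UN:
  "finite I \<Longrightarrow> (\<And>i. i \<in> I \<Longrightarrow> A i \<in> laurent_supports n d) \<Longrightarrow>
    (\<Union>i\<in>I. A i) \<in> laurent_supports n d"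
  by (induction I rule: finite_induct) (auto intro: laurent_supports_Un laurent_supports_empty)

lemma case_nat_split: "x = case_nat (x 0) (\<lambda>i. x (Suc i))"
  by (auto simp: fun_eq_iff split: nat.split)

lemma case_nat_plus: "case_nat (r + s) (a + b) = case_nat r a + case_nat s b"
  by (auto simp: fun_eq_iff split: nat.split)

text \<open>
  First exponents are multiples of \<open>1/d\<close> that are bounded below, so a given \<open>r\<close> has only finitely
  many decompositions into a first exponent from \<open>A\<close> and one from \<open>B\<close>.  The slice of the sumset at
  \<open>r\<close> is thus a finite union of sumsets of slices.
\<close>

lemma laurent_supports_plus:
  assumes "0 < d"
  shows "A \<in> laurent_supports n d \<Longrightarrow> B \<in> laurent_supports n d \<Longrightarrow> A + B \<in> laurent_supports n d"
proof (induction n arbitrary: A B)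
  case 0
  hence "a = 0 \<and> b = 0" if "a \<in> A" "b \<in> B" for a b
    using that by auto
  thus ?case by (force elim!: set_plus_elim)
next
  case (Suc n)
  obtain M where M: "\<And>r a. case_nat r a \<in> A \<Longrightarrow> M \<le> r"
    using Suc.prems by simp blast
  obtain N where N: "\<And>r a. case_nat r a \<in> B \<Longrightarrow> N \<le> r"
    using Suc.prems by simp blast
  have A: "of_nat d * r \<in> \<int>" if "case_nat r a \<in> A" for r a
    using that Suc.prems by auto
  have B: "of_nat d * r \<in> \<int>" if "case_nat r a \<in> B" for r a
    using that Suc.prems by auto
  have split: "\<exists>s b c. case_nat s b \<in> A \<and> case_nat (r - s) c \<in> B \<and> a = b + c"
    if ra: "case_nat r a \<in> A + B" for r a
  proof -
    obtain x y where xy: "case_nat r a = x + y" "x \<in> A" "y \<in> B"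
      using set_plus_elim [OF ra] by blast
    have r: "r = x 0 + y 0"
      using fun_cong [OF xy(1), of 0] by simp
    have a: "a = (\<lambda>i. x (Suc i)) + (\<lambda>i. y (Suc i))"
    proof
      fix i show "a i = ((\<lambda>i. x (Suc i)) + (\<lambda>i. y (Suc i))) i"
        using fun_cong [OF xy(1), of "Suc i"] by simp
    qed
    have "case_nat (x 0) (\<lambda>i. x (Suc i)) \<in> A" "case_nat (r - x 0) (\<lambda>i. y (Suc i)) \<in> B"
      using xy(2,3) case_nat_split [of x] case_nat_split [of y] r by auto
    thus ?thesis using a by blast
  qed
  have "{a. case_nat r a \<in> A + B} \<in> laurent_supports n d" for r
  proof (rule laurent_supports_subset)
    define R where "R = {s::rat. of_nat d * s \<in> \<int> \<and> M \<le> s \<and> s \<le> r - N}"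
    have "finite R"
      unfolding R_def using assms by (rule finite_bounded_multiples)
    thus "(\<Union>s\<in>R. {a. case_nat s a \<in> A} + {a. case_nat (r - s) a \<in> B}) \<in> laurent_supports n d"
      using Suc by (intro laurent_supports_UN) auto
    show "{a. case_nat r a \<in> A + B} \<subseteq> (\<Union>s\<in>R. {a. case_nat s a \<in> A} + {a. case_nat (r - s) a \<in> B})"
    proof
      fix a assume "a \<in> {a. case_nat r a \<in> A + B}"
      then obtain s b c where s: "case_nat s b \<in> A" "case_nat (r - s) c \<in> B" "a = b + c"
        using split by blast
      have "s \<in> R"
        using M [OF s(1)] N [OF s(2)] A [OF s(1)] by (auto simp: R_def)
      thus "a \<in> (\<Union>s\<in>R. {a. case_nat s a \<in> A} + {a. case_nat (r - s) a \<in> B})"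
        using s by (auto intro!: bexI [of _ s] set_plus_intro)
    qed
  qed
  moreover have "of_nat d * r \<in> \<int>" if ra: "case_nat r a \<in> A + B" for r a
  proof -
    obtain s b c where s: "case_nat s b \<in> A" "case_nat (r - s) c \<in> B"
      using split [OF ra] by blast
    have "of_nat d * s + of_nat d * (r - s) \<in> \<int>"
      using A [OF s(1)] B [OF s(2)] by (rule Ints_add)
    thus ?thesis by (simp add: algebra_simps)
  qed
  moreover have "M + N \<le> r" if ra: "case_nat r a \<in> A + B" for r a
  proof -
    obtain s b c where s: "case_nat s b \<in> A" "case_nat (r - s) c \<in> B"
      using split [OF ra] by blast
    thus ?thesis
      using M [OF s(1)] N [OF s(2)] by simp
  qed
  ultimately show ?case
    unfolding laurent_supports.simps by blast
qed

lemma laurent_supports_Suc: "A \<in> laurent_supports n d \<Longrightarrow> A \<in> laurent_supports (Suc n) d"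
proof (induction n arbitrary: A)
  case 0
  have "r = 0 \<and> a = 0" if "case_nat r a \<in> A" for r a
  proof -
    have *: "case_nat r a = 0"
      using 0 that by auto
    show ?thesis
      using fun_cong [OF *, of 0] fun_cong [OF *, of "Suc _"] by (auto simp: fun_eq_iff)
  qed
  thus ?case by fastforce
next
  case (Suc n)
  have "{a. case_nat r a \<in> A} \<in> laurent_supports (Suc n) d" for r
    using Suc.prems by (intro Suc.IH) simp
  with Suc.prems show ?case
    unfolding laurent_supports.simps(2) [of "Suc n"] laurent_supports.simps(2) [of n] by (intro CollectI conjI) blast+
qed

lemma laurent_supports_le: "m \<le> n \<Longrightarrow> A \<in> laurent_supports m d \<Longrightarrow> A \<in> laurent_supports n d"
  by (induction n rule: dec_induct) (auto intro: laurent_supports_Suc simp del: laurent_supports.simps)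

lemma Ints_mult_of_nat: "of_nat d * (r::rat) \<in> \<int> \<Longrightarrow> of_nat (d * e) * r \<in> \<int>"
  using Ints_mult [of "of_nat e" "of_nat d * r"] by (simp add: mult_ac)

lemma laurent_supports_refine: "A \<in> laurent_supports n d \<Longrightarrow> A \<in> laurent_supports n (d * e)"
proof (induction n arbitrary: A)
  case (Suc n)
  have "of_nat (d * e) * r \<in> \<int>" if "case_nat r a \<in> A" for r a
    using Suc.prems that by (intro Ints_mult_of_nat) auto
  thus ?case
    using Suc by auto
qed auto

lemma laurent_supports_finite_decompositions:
  assumes "0 < d" "A \<in> laurent_supports n d" "B \<in> laurent_supports n d"
  shows "finite {a \<in> A. c - a \<in> B}"
proof -
  let ?f = "\<lambda>A a. if a \<in> A then 1 else (0::rat)"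
  have "finite {a. ?f A a \<noteq> 0 \<and> ?f B (\<lambda>i. c i - a i) \<noteq> 0}"
    using assms by (intro finite_series_mult_support [of d _ n]) (auto simp: iterated_laurent_iff)
  moreover have "(\<lambda>i. c i - a i) = c - a" for a
    by auto
  ultimately show ?thesis
    by (elim rev_finite_subset) auto
qed

section \<open>The ring of all iterated Laurent series\<close>

text \<open>
  The type comprises the iterated Laurent series in any number of variables and with any denominator,
  since a type cannot depend on the variables \<open>n\<close> and \<open>d\<close>.  It makes polynomials over series
  available; the series that belong to given \<open>n\<close> and \<open>d\<close> are subsets of it.
\<close>

typedef (overloaded) 'k lseries =
  "{f :: (nat \<Rightarrow> rat) \<Rightarrow> 'k::field. \<exists>n d. 0 < d \<and> f \<in> iterated_laurent n d}"
  morphisms lcoeff Abs_lseries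
proof
  show "(\<lambda>_. 0) \<in> {f :: (nat \<Rightarrow> rat) \<Rightarrow> 'k. \<exists>n d. 0 < d \<and> f \<in> iterated_laurent n d}"
    by (rule CollectI, rule exI [of _ 0], rule exI [of _ 1]) simp
qed

definition lsupp :: "'k::field lseries \<Rightarrow> (nat \<Rightarrow> rat) set" where
  "lsupp x = {a. lcoeff x a \<noteq> 0}"

lemma lsupp_iff: "a \<in> lsupp x \<longleftrightarrow> lcoeff x a \<noteq> 0"
  by (simp add: lsupp_def)

lemma lseries_eqI: "(\<And>a. lcoeff x a = lcoeff y a) \<Longrightarrow> x = y"
  by (rule lcoeff_inject [THEN iffD1]) (rule ext)

lemma lcoeff_Abs:
  assumes "0 < d" "A \<in> laurent_supports n d" "\<And>a. f a \<noteq> 0 \<Longrightarrow> a \<in> A"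
  shows "lcoeff (Abs_lseries f) = f"
proof (rule Abs_lseries_inverse)
  have "{a. f a \<noteq> 0} \<in> laurent_supports n d"
    using assms by (auto intro: laurent_supports_subset)
  thus "f \<in> {f. \<exists>n d. 0 < d \<and> f \<in> iterated_laurent n d}"
    unfolding mem_Collect_eq iterated_laurent_iff using assms(1) by (intro exI conjI)
qed

lemma lsupp_laurent_supports: "\<exists>n d. 0 < d \<and> lsupp x \<in> laurent_supports n d"
  using lcoeff [of x] unfolding mem_Collect_eq iterated_laurent_iff lsupp_def .

lemma lsupp_common_laurent_supports:
  "\<exists>n d. 0 < d \<and> lsupp x \<in> laurent_supports n d \<and> lsupp y \<in> laurent_supports n d"
proof -
  obtain n d m e where *: "0 < d" "lsupp x \<in> laurent_supports n d" "0 < e" "lsupp y \<in> laurent_supports m e"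
    using lsupp_laurent_supports by metis
  have "lsupp x \<in> laurent_supports (max n m) (d * e)"
    using * by (intro laurent_supports_refine laurent_supports_le [of n "max n m"]) auto
  moreover have "lsupp y \<in> laurent_supports (max n m) (e * d)"
    using * by (intro laurent_supports_refine laurent_supports_le [of m "max n m"]) auto
  ultimately show ?thesis
    using * by (intro exI [of _ "max n m"] exI [of _ "d * e"]) (auto simp: mult.commute)
qed

lemma series_mult_eq_sum:
  assumes "finite A" "\<And>a. f a \<noteq> 0 \<Longrightarrow> g (c - a) \<noteq> 0 \<Longrightarrow> a \<in> A"
  shows "series_mult f g c = (\<Sum>a\<in>A. f a * g (c - a))"
proof -
  have *: "(\<lambda>i. c i - a i) = c - a" for a
    by auto
  show ?thesis
    unfolding series_mult_def * using assms by (intro sum.mono_neutral_left) auto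
qed

lemma series_mult_support:
  assumes "series_mult f g c \<noteq> 0"
  shows "c \<in> {a. f a \<noteq> 0} + {a. g a \<noteq> 0}"
proof -
  obtain a where "f a \<noteq> 0" "g (\<lambda>i. c i - a i) \<noteq> 0"
    using assms unfolding series_mult_def by (elim sum.not_neutral_contains_not_neutral) auto
  hence "a + (\<lambda>i. c i - a i) \<in> {a. f a \<noteq> 0} + {a. g a \<noteq> 0}"
    by (intro set_plus_intro) auto
  moreover have "c = a + (\<lambda>i. c i - a i)"
    by auto
  ultimately show ?thesis
    by simp
qed

instantiation lseries :: (field) comm_ring_1
begin

definition "0 = Abs_lseries (\<lambda>_. 0)"
definition "1 = Abs_lseries (\<lambda>a. if a = (\<lambda>_. 0) then 1 else 0)"
definition "x + y = Abs_lseries (\<lambda>a. lcoeff x a + lcoeff y a)"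
definition "- x = Abs_lseries (\<lambda>a. - lcoeff x a)"
definition "x - y = (x :: 'a lseries) + - y"
definition "x * y = Abs_lseries (series_mult (lcoeff x) (lcoeff y))"

lemma lcoeff_0: "lcoeff 0 = (\<lambda>_. 0)"
  unfolding zero_lseries_def by (rule lcoeff_Abs [of 1 "{}" 0]) simp_all

lemma lcoeff_1: "lcoeff 1 = (\<lambda>a. if a = (\<lambda>_. 0) then 1 else 0)"
  unfolding one_lseries_def
proof (rule lcoeff_Abs)
  show "0 < (1::nat)" "{\<lambda>_. 0} \<in> laurent_supports 0 1"
    by (simp_all add: zero_fun_def)
qed (auto split: if_splits)

lemma lcoeff_add: "lcoeff (x + y) = (\<lambda>a. lcoeff x a + lcoeff y a)"
proof -
  obtain n d where "0 < d" "lsupp x \<in> laurent_supports n d" "lsupp y \<in> laurent_supports n d"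
    using lsupp_common_laurent_supports [of x y] by blast
  moreover have "a \<in> lsupp x \<union> lsupp y" if "lcoeff x a + lcoeff y a \<noteq> 0" for a
    using that by (cases "lcoeff x a = 0") (simp_all add: lsupp_iff)
  ultimately show ?thesis
    unfolding plus_lseries_def by (intro lcoeff_Abs [of d "lsupp x \<union> lsupp y" n] laurent_supports_Un)
qed

lemma lcoeff_uminus: "lcoeff (- x) = (\<lambda>a. - lcoeff x a)"
proof -
  obtain n d where "0 < d" "lsupp x \<in> laurent_supports n d"
    using lsupp_laurent_supports by blast
  thus ?thesis
    unfolding uminus_lseries_def
    by (rule lcoeff_Abs) (simp add: lsupp_iff)
qed


lemma lcoeff_mult: "lcoeff (x * y) = series_mult (lcoeff x) (lcoeff y)"
proof -
  obtain n d where "0 < d" "lsupp x \<in> laurent_supports n d" "lsupp y \<in> laurent_supports n d"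
    using lsupp_common_laurent_supports [of x y] by blast
  thus ?thesis
    unfolding times_lseries_def
    by (intro lcoeff_Abs [of d "lsupp x + lsupp y" n] laurent_supports_plus)
      (simp_all add: lsupp_def series_mult_support)
qed

lemma lsupp_mult: "lsupp (x * y) \<subseteq> lsupp x + lsupp y"
proof
  fix c assume "c \<in> lsupp (x * y)"
  hence "series_mult (lcoeff x) (lcoeff y) c \<noteq> 0"
    by (simp add: lsupp_def lcoeff_mult)
  from series_mult_support [OF this] show "c \<in> lsupp x + lsupp y"
    by (simp add: lsupp_def)
qed

lemma finite_lsupp_decompositions: "finite {a \<in> lsupp x. c - a \<in> lsupp y}"
proof -
  obtain n d where "0 < d" "lsupp x \<in> laurent_supports n d" "lsupp y \<in> laurent_supports n d"
    using lsupp_common_laurent_supports [of x y] by blast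
  thus ?thesis
    by (rule laurent_supports_finite_decompositions)
qed

lemma lcoeff_mult_eq_sum:
  assumes "finite A" "\<And>a. lcoeff x a \<noteq> 0 \<Longrightarrow> lcoeff y (c - a) \<noteq> 0 \<Longrightarrow> a \<in> A"
  shows "lcoeff (x * y) c = (\<Sum>a\<in>A. lcoeff x a * lcoeff y (c - a))"
  unfolding lcoeff_mult using assms by (rule series_mult_eq_sum)

lemma lcoeff_mult_conv_sum:
  "lcoeff (x * y) c = (\<Sum>a | a \<in> lsupp x \<and> c - a \<in> lsupp y. lcoeff x a * lcoeff y (c - a))"
  using finite_lsupp_decompositions by (rule lcoeff_mult_eq_sum) (auto simp: lsupp_iff)

text \<open>
  Both bracketings are the sum over the finite set \<open>T\<close> of all pairs \<open>(a, b)\<close> such that \<open>a\<close>,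
  \<open>b\<close> and \<open>c - a - b\<close> lie in the three supports.
\<close>

lemma lseries_mult_assoc: "(x * y) * z = x * (y * z)" for x y z :: "'a lseries"
proof (rule lseries_eqI)
  fix c
  obtain n d where nd: "0 < d" "lsupp x \<in> laurent_supports n d" "lsupp y \<in> laurent_supports n d"
    using lsupp_common_laurent_supports [of x y] by blast
  have fin2: "finite {a \<in> lsupp x + lsupp y. c - a \<in> lsupp z}"
  proof -
    obtain m e where me: "0 < e" "lsupp z \<in> laurent_supports m e"
      using lsupp_laurent_supports by blast
    have "lsupp x + lsupp y \<in> laurent_supports (max n m) (d * e)"
      using nd by (intro laurent_supports_refine laurent_supports_le [of n "max n m"] laurent_supports_plus) auto
    moreover have "lsupp z \<in> laurent_supports (max n m) (d * e)"
      using laurent_supports_refine [OF laurent_supports_le [OF _ me(2)], of "max n m" d] by (simp add: mult.commute)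
    ultimately show ?thesis
      using nd me by (intro laurent_supports_finite_decompositions [of "d * e" _ "max n m"]) auto
  qed
  let ?F = "{s \<in> lsupp x + lsupp y. c - s \<in> lsupp z}"
  let ?G = "\<lambda>s. {a \<in> lsupp x. s - a \<in> lsupp y}"
  have finG: "finite (?G s)" for s
    by (rule finite_lsupp_decompositions)
  let ?t = "\<lambda>a b. lcoeff x a * (lcoeff y b * lcoeff z (c - a - b))"
  define T where "T = (\<lambda>(s, a). (a, s - a)) ` Sigma ?F ?G"
  have finT: "finite T"
    unfolding T_def using fin2 finG by (intro finite_imageI finite_SigmaI) auto
  have T: "T = {(a, b). a \<in> lsupp x \<and> b \<in> lsupp y \<and> c - a - b \<in> lsupp z}"
  proof (intro Set.set_eqI iffI)
    fix p assume "p \<in> {(a, b). a \<in> lsupp x \<and> b \<in> lsupp y \<and> c - a - b \<in> lsupp z}"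
    then obtain a b where p: "p = (a, b)" "a \<in> lsupp x" "b \<in> lsupp y" "c - a - b \<in> lsupp z"
      by blast
    hence "(a + b, a) \<in> Sigma ?F ?G"
      by (auto simp: diff_diff_eq)
    moreover have "p = (\<lambda>(s, a). (a, s - a)) (a + b, a)"
      using p by simp
    ultimately show "p \<in> T"
      unfolding T_def by (rule rev_image_eqI)
  qed (auto simp: T_def)
  have "lcoeff (x * y * z) c = (\<Sum>s\<in>?F. lcoeff (x * y) s * lcoeff z (c - s))"
    using fin2
  proof (rule lcoeff_mult_eq_sum)
    fix s assume "lcoeff (x * y) s \<noteq> 0" "lcoeff z (c - s) \<noteq> 0"
    thus "s \<in> ?F"
      using subsetD [OF lsupp_mult, of s x y] by (simp add: lsupp_iff)
  qed
  also have "\<dots> = (\<Sum>s\<in>?F. \<Sum>a\<in>?G s. lcoeff x a * lcoeff y (s - a) * lcoeff z (c - s))"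
    by (simp add: lcoeff_mult_conv_sum sum_distrib_right)
  also have "\<dots> = (\<Sum>(s, a)\<in>Sigma ?F ?G. lcoeff x a * lcoeff y (s - a) * lcoeff z (c - s))"
    using fin2 finG by (intro sum.Sigma) auto
  also have "\<dots> = (\<Sum>(a, b)\<in>T. ?t a b)"
    unfolding T_def
    by (subst sum.reindex) (auto simp: inj_on_def mult.assoc intro!: sum.cong)
  finally have lhs: "lcoeff (x * y * z) c = (\<Sum>(a, b)\<in>T. ?t a b)" .
  let ?A = "fst ` T"
  let ?B = "\<lambda>a. {b \<in> lsupp y. c - a - b \<in> lsupp z}"
  have "lcoeff (x * (y * z)) c = (\<Sum>a\<in>?A. lcoeff x a * lcoeff (y * z) (c - a))"
  proof (rule lcoeff_mult_eq_sum)
    fix a assume a: "lcoeff x a \<noteq> 0" "lcoeff (y * z) (c - a) \<noteq> 0"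
    then obtain b where "b \<in> lsupp y" "c - a - b \<in> lsupp z"
      by (auto simp: lcoeff_mult_conv_sum elim: sum.not_neutral_contains_not_neutral)
    with a have "(a, b) \<in> T"
      by (auto simp: T lsupp_iff)
    thus "a \<in> ?A" by force
  qed (use finT in auto)
  also have "\<dots> = (\<Sum>a\<in>?A. \<Sum>b\<in>?B a. ?t a b)"
    by (simp add: lcoeff_mult_conv_sum sum_distrib_left)
  also have "\<dots> = (\<Sum>(a, b)\<in>Sigma ?A ?B. ?t a b)"
    using finT finite_lsupp_decompositions by (intro sum.Sigma) auto
  also have "Sigma ?A ?B = T"
    unfolding T by force
  finally show "lcoeff (x * y * z) c = lcoeff (x * (y * z)) c"
    using lhs by (simp add: fun_diff_def)
qed

lemma lseries_mult_commute: "x * y = y * x" for x y :: "'a lseries"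
proof (rule lseries_eqI)
  fix c
  show "lcoeff (x * y) c = lcoeff (y * x) c"
    unfolding lcoeff_mult_conv_sum
    by (rule sum.reindex_bij_witness [of _ "\<lambda>a. c - a" "\<lambda>a. c - a"]) (auto simp: mult.commute)
qed

lemma lseries_distrib: "(x + y) * z = x * z + y * z" for x y z :: "'a lseries"
proof (rule lseries_eqI)
  fix c
  let ?A = "{a \<in> lsupp x. c - a \<in> lsupp z} \<union> {a \<in> lsupp y. c - a \<in> lsupp z}"
  have fin: "finite ?A"
    by (intro finite_UnI finite_lsupp_decompositions)
  have "lcoeff ((x + y) * z) c = (\<Sum>a\<in>?A. lcoeff (x + y) a * lcoeff z (c - a))"
    using fin by (rule lcoeff_mult_eq_sum) (auto simp: lsupp_iff lcoeff_add)
  moreover have "lcoeff (x * z) c = (\<Sum>a\<in>?A. lcoeff x a * lcoeff z (c - a))"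
    using fin by (rule lcoeff_mult_eq_sum) (auto simp: lsupp_iff)
  moreover have "lcoeff (y * z) c = (\<Sum>a\<in>?A. lcoeff y a * lcoeff z (c - a))"
    using fin by (rule lcoeff_mult_eq_sum) (auto simp: lsupp_iff)
  ultimately show "lcoeff ((x + y) * z) c = lcoeff (x * z + y * z) c"
    by (simp add: lcoeff_add sum.distrib algebra_simps)
qed

instance
proof
  fix x y z :: "'a lseries"
  show "x * y * z = x * (y * z)" by (rule lseries_mult_assoc)
  show "x * y = y * x" by (rule lseries_mult_commute)
  show "(x + y) * z = x * z + y * z" by (rule lseries_distrib)
  show "1 * x = x"
  proof (rule lseries_eqI)
    fix c
    have "lcoeff (1 * x) c = (\<Sum>a\<in>{0}. lcoeff 1 a * lcoeff x (c - a))"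
      by (rule lcoeff_mult_eq_sum) (auto simp: lcoeff_1 split: if_splits)
    thus "lcoeff (1 * x) c = lcoeff x c"
      by (simp add: lcoeff_1 zero_fun_def)
  qed
  show "(0::'a lseries) \<noteq> 1"
  proof
    assume "(0::'a lseries) = 1"
    hence "lcoeff (0::'a lseries) (\<lambda>_. 0) = lcoeff 1 (\<lambda>_. 0)"
      by (rule arg_cong)
    thus False
      by (simp add: lcoeff_0 lcoeff_1)
  qed
qed (rule lseries_eqI; simp add: lcoeff_add lcoeff_0 lcoeff_uminus minus_lseries_def add_ac)+

end

section \<open>Lattice points of translated cones\<close>

definition exponents :: "nat \<Rightarrow> nat \<Rightarrow> (nat \<Rightarrow> rat) set" where
  "exponents n d = {a. (\<forall>i\<ge>n. a i = 0) \<and> (\<forall>i. of_nat d * a i \<in> \<int>)}"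

lemma exponents_zero: "0 \<in> exponents n d"
  by (simp add: exponents_def)

lemma exponents_add: "a \<in> exponents n d \<Longrightarrow> b \<in> exponents n d \<Longrightarrow> a + b \<in> exponents n d"
  by (auto simp: exponents_def distrib_left)

lemma exponents_uminus: "a \<in> exponents n d \<Longrightarrow> - a \<in> exponents n d"
  by (auto simp: exponents_def)


lemma exponents_refine: "a \<in> exponents n d \<Longrightarrow> a \<in> exponents n (d * e)"
  unfolding exponents_def using Ints_mult_of_nat by blast

lemma exponents_prefix_sum_pow:
  assumes "a \<in> exponents n d"
  shows "of_nat d * (prefix_sum ^^ N) a i \<in> \<int>"
proof (induction N arbitrary: i)
  case (Suc N)
  thus ?case
    by (auto simp: prefix_sum_def [of "(prefix_sum ^^ N) a"] sum_distrib_left)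
qed (use assms in \<open>simp add: exponents_def\<close>)

text \<open>
  The lattice points of a translate of the \<open>N\<close>-th cone.  The bound \<open>-c\<close> in the coordinates given
  by the prefix sums stands for the apex, because such bounds simply add up under sums of exponents;
  \<open>c = 0\<close> gives the lattice points of the cone itself.
\<close>

definition shifted_cone :: "nat \<Rightarrow> nat \<Rightarrow> nat \<Rightarrow> rat \<Rightarrow> (nat \<Rightarrow> rat) set" where
  "shifted_cone n d N c = {a \<in> exponents n d. \<forall>i<n. - c \<le> (prefix_sum ^^ N) a i}"

lemma shifted_cone_exponents: "a \<in> shifted_cone n d N c \<Longrightarrow> a \<in> exponents n d"
  by (simp add: shifted_cone_def)

lemma exponents_shifted_cone: "a \<in> exponents n d \<Longrightarrow> \<exists>c\<ge>0. a \<in> shifted_cone n d N c"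
proof (intro exI conjI)
  assume a: "a \<in> exponents n d"
  let ?c = "\<Sum>i<n. \<bar>(prefix_sum ^^ N) a i\<bar>"
  show "0 \<le> ?c"
    by (simp add: sum_nonneg)
  have "\<bar>(prefix_sum ^^ N) a i\<bar> \<le> ?c" if "i < n" for i
    using that by (intro member_le_sum) auto
  hence "- ?c \<le> (prefix_sum ^^ N) a i" if "i < n" for i
    using that by (meson abs_le_D2 minus_le_iff)
  thus "a \<in> shifted_cone n d N ?c"
    using a by (simp add: shifted_cone_def)
qed

lemma shifted_cone_mono: "c \<le> c' \<Longrightarrow> shifted_cone n d N c \<subseteq> shifted_cone n d N c'"
  by (force simp: shifted_cone_def)

lemma shifted_cone_refine: "shifted_cone n d N c \<subseteq> shifted_cone n (d * e) N c"
  by (auto simp: shifted_cone_def exponents_refine)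

lemma shifted_cone_zero: "0 \<le> c \<Longrightarrow> 0 \<in> shifted_cone n d N c"
  by (simp add: shifted_cone_def exponents_zero prefix_sum_pow_zero)

lemma shifted_cone_add:
  "a \<in> shifted_cone n d N c \<Longrightarrow> b \<in> shifted_cone n d N c' \<Longrightarrow> a + b \<in> shifted_cone n d N (c + c')"
  by (force simp: shifted_cone_def exponents_add prefix_sum_pow_add)

text \<open>
  An entry of the new prefix sum has at most \<open>n\<close> summands, each at least \<open>-c\<close>.
\<close>

lemma shifted_cone_Suc:
  assumes "0 \<le> c"
  shows "shifted_cone n d N c \<subseteq> shifted_cone n d (Suc N) (of_nat n * c)"
proof
  fix a assume a: "a \<in> shifted_cone n d N c"
  have "- (of_nat n * c) \<le> (prefix_sum ^^ Suc N) a i" if "i < n" for i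
  proof -
    have "(\<Sum>l\<le>i. - c) \<le> (\<Sum>l\<le>i. (prefix_sum ^^ N) a l)"
      using a that by (intro sum_mono) (auto simp: shifted_cone_def)
    moreover have "of_nat (Suc i) * c \<le> of_nat n * c"
      using that assms by (intro mult_right_mono) (auto simp del: of_nat_Suc)
    ultimately show ?thesis
      by (simp add: prefix_sum_def [of "(prefix_sum ^^ N) a"] sum_negf)
  qed
  thus "a \<in> shifted_cone n d (Suc N) (of_nat n * c)"
    using a by (simp add: shifted_cone_def)
qed

lemma shifted_cone_raise:
  assumes "N \<le> M" "0 \<le> c"
  shows "\<exists>c'\<ge>0. shifted_cone n d N c \<subseteq> shifted_cone n d M c'"
  using assms(1)
proof (induction M rule: dec_induct)
  case base
  show ?case using assms(2) by blast
next
  case (step M)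
  then obtain c' where "0 \<le> c'" "shifted_cone n d N c \<subseteq> shifted_cone n d M c'"
    by blast
  thus ?case
    using shifted_cone_Suc [of c' n d M] by (intro exI [of _ "of_nat n * c'"]) auto
qed

lemma shifted_cone_directed:
  "\<exists>N c. 0 \<le> c \<and> shifted_cone n d N1 c1 \<subseteq> shifted_cone n d N c \<and>
    shifted_cone n d N2 c2 \<subseteq> shifted_cone n d N c"
proof -
  let ?N = "max N1 N2"
  obtain c1' where c1: "0 \<le> c1'" "shifted_cone n d N1 (max c1 0) \<subseteq> shifted_cone n d ?N c1'"
    using shifted_cone_raise [of N1 ?N "max c1 0" n d] by auto
  obtain c2' where c2: "0 \<le> c2'" "shifted_cone n d N2 (max c2 0) \<subseteq> shifted_cone n d ?N c2'"
    using shifted_cone_raise [of N2 ?N "max c2 0" n d] by auto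
  have "shifted_cone n d N1 c1 \<subseteq> shifted_cone n d ?N (c1' + c2')"
    using shifted_cone_mono [of c1 "max c1 0" n d N1] c1(2) shifted_cone_mono [of c1' "c1' + c2'" n d ?N] c2(1) by auto
  moreover have "shifted_cone n d N2 c2 \<subseteq> shifted_cone n d ?N (c1' + c2')"
    using shifted_cone_mono [of c2 "max c2 0" n d N2] c2(2) shifted_cone_mono [of c2' "c1' + c2'" n d ?N] c1(1) by auto
  ultimately show ?thesis
    using c1(1) c2(1) by (intro exI [of _ ?N] exI [of _ "c1' + c2'"]) simp
qed

lemma prefix_sum_pow_case_nat_0:
  "(prefix_sum ^^ N) (case_nat 0 a) = case_nat 0 ((prefix_sum ^^ N) a)"
proof (induction N)
  case (Suc N)
  have "prefix_sum (case_nat 0 b) = case_nat 0 (prefix_sum b)" for b :: "nat \<Rightarrow> 'a"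
  proof
    fix i show "prefix_sum (case_nat 0 b) i = case_nat 0 (prefix_sum b) i"
    proof (cases i)
      case (Suc j)
      show ?thesis
        unfolding prefix_sum_def Suc by (subst sum.atMost_Suc_shift) (simp add: prefix_sum_def)
    qed (simp add: prefix_sum_def)
  qed
  with Suc show ?case
    by (simp only: funpow.simps o_apply)
qed (simp only: funpow.simps id_apply)

lemma prefix_sum_pow_at_0: "(prefix_sum ^^ N) a 0 = a 0"
  by (induction N) (simp_all add: prefix_sum_def)

text \<open>
  Fixing the first exponent \<open>r\<close> changes the prefix sums of the remaining exponents by a vector that
  depends on \<open>r\<close> alone, so each slice is contained in a shifted cone of one dimension less.
\<close>

lemma shifted_cone_in_laurent_supports: "shifted_cone n d N c \<in> laurent_supports n d"
proof (induction n arbitrary: c)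
  case 0
  show ?case
    by (auto simp: shifted_cone_def exponents_def)
next
  case (Suc n)
  have "{a. case_nat r a \<in> shifted_cone (Suc n) d N c} \<in> laurent_supports n d" for r
  proof (rule laurent_supports_subset)
    let ?e = "\<lambda>i. (prefix_sum ^^ N) (case_nat r 0) (Suc i)"
    let ?c = "c + (\<Sum>i<n. \<bar>?e i\<bar>)"
    show "shifted_cone n d N ?c \<in> laurent_supports n d"
      by (rule Suc.IH)
    show "{a. case_nat r a \<in> shifted_cone (Suc n) d N c} \<subseteq> shifted_cone n d N ?c"
    proof
      fix a assume "a \<in> {a. case_nat r a \<in> shifted_cone (Suc n) d N c}"
      hence a: "case_nat r a \<in> exponents (Suc n) d" "\<And>i. i < Suc n \<Longrightarrow> - c \<le> (prefix_sum ^^ N) (case_nat r a) i"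
        by (auto simp: shifted_cone_def)
      have "a i = 0" if "n \<le> i" for i
        using a(1) that unfolding exponents_def by (auto dest: spec [of _ "Suc i"])
      moreover have "of_nat d * a i \<in> \<int>" for i
        using a(1) unfolding exponents_def by (auto dest: spec [of _ "Suc i"])
      moreover have "- ?c \<le> (prefix_sum ^^ N) a i" if "i < n" for i
      proof -
        have "case_nat r a = case_nat r 0 + case_nat 0 a"
          using case_nat_plus [of r 0 0 a] by simp
        hence "(prefix_sum ^^ N) (case_nat r a) (Suc i) = ?e i + (prefix_sum ^^ N) a i"
          by (simp add: prefix_sum_pow_add prefix_sum_pow_case_nat_0)
        moreover have "- c \<le> (prefix_sum ^^ N) (case_nat r a) (Suc i)"
          using a(2) [of "Suc i"] that by simp
        moreover have "\<bar>?e i\<bar> \<le> (\<Sum>i<n. \<bar>?e i\<bar>)"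
          using that by (intro member_le_sum) auto
        ultimately show ?thesis
          by linarith
      qed
      ultimately show "a \<in> shifted_cone n d N ?c"
        by (simp add: shifted_cone_def exponents_def)
    qed
  qed
  moreover have "of_nat d * r \<in> \<int>" if "case_nat r a \<in> shifted_cone (Suc n) d N c" for r a
    using that unfolding shifted_cone_def exponents_def by (auto dest: spec [of _ 0])
  moreover have "- c \<le> r" if "case_nat r a \<in> shifted_cone (Suc n) d N c" for r a
    using that by (auto simp: shifted_cone_def prefix_sum_pow_at_0 dest: spec [of _ 0])
  ultimately show ?case
    unfolding laurent_supports.simps by blast
qed

section \<open>The lexicographic order of exponents\<close>

definition lex_nonneg :: "(nat \<Rightarrow> rat) \<Rightarrow> bool" where
  "lex_nonneg a \<longleftrightarrow> a = 0 \<or> (\<exists>i. 0 < a i \<and> (\<forall>j<i. a j = 0))"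

lemma first_nonzero:
  fixes a :: "nat \<Rightarrow> 'a::zero"
  assumes "a \<noteq> 0"
  obtains i where "a i \<noteq> 0" "\<And>j. j < i \<Longrightarrow> a j = 0"
proof -
  obtain i where "a i \<noteq> 0"
    using assms by (auto simp: fun_eq_iff)
  thus ?thesis
    using that [of "LEAST i. a i \<noteq> 0"] LeastI [of "\<lambda>i. a i \<noteq> 0"] not_less_Least by blast
qed

lemma lex_nonneg_zero: "lex_nonneg 0" "lex_nonneg (\<lambda>_. 0)"
  by (simp_all add: lex_nonneg_def zero_fun_def)

lemma lex_nonneg_total: "lex_nonneg a \<or> lex_nonneg (- a)"
proof (cases "a = 0")
  case False
  then obtain i where "a i \<noteq> 0" "\<And>j. j < i \<Longrightarrow> a j = 0"
    using first_nonzero by blast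
  hence "lex_nonneg (if 0 < a i then a else - a)"
    unfolding lex_nonneg_def by (intro disjI2 exI [of _ i]) auto
  thus ?thesis
    by (auto split: if_splits)
qed (simp add: lex_nonneg_def)

lemma lex_nonneg_add:
  assumes "lex_nonneg a" "lex_nonneg b"
  shows "lex_nonneg (a + b)"
proof (cases "a = 0 \<or> b = 0")
  case False
  obtain i where i: "0 < a i" "\<And>j. j < i \<Longrightarrow> a j = 0"
    using assms False by (auto simp: lex_nonneg_def)
  obtain k where k: "0 < b k" "\<And>j. j < k \<Longrightarrow> b j = 0"
    using assms False by (auto simp: lex_nonneg_def)
  have "0 < a (min i k) + b (min i k)"
    using i k by (cases i k rule: linorder_cases) (auto simp: min_def)
  thus ?thesis
    unfolding lex_nonneg_def using i k by (intro disjI2 exI [of _ "min i k"]) auto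
qed (use assms in auto)

lemma lex_nonneg_scale:
  assumes "lex_nonneg a" "0 \<le> c"
  shows "lex_nonneg (\<lambda>i. c * a i)"
proof (cases "c = 0")
  case True
  thus ?thesis by (simp add: lex_nonneg_def zero_fun_def)
next
  case False
  hence c: "0 < c" using assms by simp
  show ?thesis
  proof (cases "a = 0")
    case True
    thus ?thesis by (simp add: lex_nonneg_def zero_fun_def)
  next
    case False
    then obtain i where "0 < a i" "\<And>j. j < i \<Longrightarrow> a j = 0"
      using assms by (auto simp: lex_nonneg_def)
    thus ?thesis
      unfolding lex_nonneg_def using c by (intro disjI2 exI [of _ i]) auto
  qed
qed

lemma lex_nonneg_prefix_sum_pow: "lex_nonneg a \<Longrightarrow> lex_nonneg ((prefix_sum ^^ N) a)"
proof (induction N)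
  case (Suc N)
  have "lex_nonneg (prefix_sum b)" if lb: "lex_nonneg b" for b
  proof (cases "b = 0")
    case True
    thus ?thesis using prefix_sum_pow_zero [where 'a = rat, of 1] by (simp add: lex_nonneg_def)
  next
    case False
    then obtain i where "0 < b i" "\<And>j. j < i \<Longrightarrow> b j = 0"
      using lb by (auto simp: lex_nonneg_def)
    thus ?thesis
      unfolding lex_nonneg_def by (intro disjI2 exI [of _ i]) (simp add: prefix_sum_def lessThan_Suc_atMost [symmetric])
  qed
  thus ?case using Suc by simp
qed simp

lemma lex_minimum_finite:
  assumes "finite A" "A \<noteq> {}"
  shows "\<exists>m\<in>A. \<forall>a\<in>A. lex_nonneg (f a - f m)"
  using assms
proof (induction A rule: finite_ne_induct)
  case (singleton x)
  thus ?case by (simp add: lex_nonneg_zero)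
next
  case (insert x A)
  then obtain m where m: "m \<in> A" "\<And>a. a \<in> A \<Longrightarrow> lex_nonneg (f a - f m)"
    by blast
  show ?case
  proof (cases "lex_nonneg (f x - f m)")
    case True
    thus ?thesis
      using m by blast
  next
    case False
    hence xm: "lex_nonneg (f m - f x)"
      using lex_nonneg_total [of "f x - f m"] by (simp only: minus_diff_eq simp_thms)
    have "lex_nonneg (f a - f x)" if "a \<in> A" for a
      using lex_nonneg_add [OF m(2) [OF that] xm] by (simp only: diff_add_cancel add_diff_eq)
    moreover have "lex_nonneg (f x - f x)"
      by (simp only: diff_self lex_nonneg_zero)
    ultimately show ?thesis
      by blast
  qed
qed

text \<open>
  There is a least first exponent because these are multiples of \<open>1/d\<close> bounded below; the remaining
  exponents of the minimum come from the slice at it, by induction.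
\<close>

lemma laurent_supports_lex_minimum:
  assumes "0 < d" "A \<in> laurent_supports n d" "A \<noteq> {}"
  shows "\<exists>m\<in>A. \<forall>a\<in>A. lex_nonneg (a - m)"
  using assms(2,3)
proof (induction n arbitrary: A)
  case 0
  hence "A = {0}" by auto
  thus ?case by (simp add: lex_nonneg_zero)
next
  case (Suc n)
  obtain N where N: "\<And>r a. case_nat r a \<in> A \<Longrightarrow> N \<le> r"
    using Suc.prems by simp blast
  obtain x where x: "x \<in> A"
    using Suc.prems by blast
  let ?R = "{a 0 |a. a \<in> A \<and> a 0 \<le> x 0}"
  have "?R \<subseteq> {r. of_nat d * r \<in> \<int> \<and> N \<le> r \<and> r \<le> x 0}"
  proof
    fix r assume "r \<in> ?R"
    then obtain a where a: "a \<in> A" "r = a 0" "a 0 \<le> x 0"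
      by blast
    hence "case_nat r (\<lambda>i. a (Suc i)) \<in> A"
      using case_nat_split [of a] by simp
    thus "r \<in> {r. of_nat d * r \<in> \<int> \<and> N \<le> r \<and> r \<le> x 0}"
      using N Suc.prems a by auto
  qed
  hence fin: "finite ?R"
    using finite_bounded_multiples [OF assms(1)] finite_subset by blast
  have ne: "?R \<noteq> {}"
    using x by blast
  define r where "r = Min ?R"
  have "r \<in> ?R"
    unfolding r_def using fin ne by (rule Min_in)
  then obtain a where a: "a \<in> A" "r = a 0" "a 0 \<le> x 0"
    by blast
  have r: "r \<le> b 0" if "b \<in> A" for b
  proof (cases "b 0 \<le> x 0")
    case True
    hence "b 0 \<in> ?R" using that by blast
    thus ?thesis unfolding r_def using fin by (rule Min_le [rotated])
  qed (use a in simp)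
  have "case_nat r (\<lambda>i. a (Suc i)) \<in> A"
    using a case_nat_split [of a] by simp
  hence "{b. case_nat r b \<in> A} \<noteq> {}"
    by blast
  moreover have "{b. case_nat r b \<in> A} \<in> laurent_supports n d"
    using Suc.prems by simp
  ultimately obtain m where m: "case_nat r m \<in> A" "\<And>b. case_nat r b \<in> A \<Longrightarrow> lex_nonneg (b - m)"
    using Suc.IH by blast
  have "lex_nonneg (b - case_nat r m)" if b: "b \<in> A" for b
  proof (cases "b 0 = r")
    case True
    let ?b = "\<lambda>i. b (Suc i)"
    have b': "b = case_nat r ?b"
      using case_nat_split [of b] True by simp
    have l: "lex_nonneg (?b - m)"
      using m(2) b b' by simp
    have *: "b - case_nat r m = case_nat 0 (?b - m)"
      by (subst b') (auto simp: fun_eq_iff split: nat.split)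
    show ?thesis
    proof (cases "?b - m = 0")
      case True
      thus ?thesis
        unfolding * lex_nonneg_def by (intro disjI1) (auto simp: fun_eq_iff split: nat.split)
    next
      case False
      then obtain i where "0 < (?b - m) i" "\<And>j. j < i \<Longrightarrow> (?b - m) j = 0"
        using l unfolding lex_nonneg_def by blast
      thus ?thesis
        unfolding * lex_nonneg_def
        by (intro disjI2 exI [of _ "Suc i"]) (auto simp del: minus_apply split: nat.split)
    qed
  next
    case False
    hence "0 < (b - case_nat r m) 0"
      using r [OF b] by simp
    thus ?thesis
      unfolding lex_nonneg_def by blast
  qed
  thus ?case
    using m(1) by blast
qed

lemma Ints_pos_ge_inverse:
  assumes "0 < d" "of_nat d * r \<in> \<int>" "0 < (r::rat)"
  shows "1 \<le> of_nat d * r"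
proof -
  obtain z where z: "of_nat d * r = of_int z"
    using assms(2) by (elim Ints_cases)
  have "0 < of_nat d * r"
    using assms by simp
  thus ?thesis
    unfolding z by simp
qed

text \<open>
  The first nonzero entry of a lexicographically nonnegative lattice vector is at least \<open>1/d\<close>, and
  a later entry, being at least \<open>-c\<close>, is compensated by \<open>c d\<close> times that entry.  So the number
  of prefix sums after which all entries are nonnegative does not depend on the vector.
\<close>

lemma lex_nonneg_shifted_cone_in_cone:
  assumes d: "0 < d"
  shows "\<exists>M. \<forall>a\<in>shifted_cone n d N c. lex_nonneg a \<longrightarrow> a \<in> shifted_cone n d M 0"
proof -
  define c' where "c' = max c 0"
  define C where "C = c' * of_nat d"
  have c': "0 \<le> c'" "c \<le> c'" and C: "0 \<le> C"
    by (auto simp: c'_def C_def)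
  obtain K where K: "\<And>a b i. dominates n C a b \<Longrightarrow> i < n \<Longrightarrow> 0 \<le> (prefix_sum ^^ K) b i"
    using prefix_sum_pow_eventually_nonneg [OF C] by blast
  have "a \<in> shifted_cone n d (K + N) 0" if a: "a \<in> shifted_cone n d N c" and lex: "lex_nonneg a" for a
  proof -
    define b where "b = (prefix_sum ^^ N) a"
    have b: "lex_nonneg b"
      unfolding b_def using lex by (rule lex_nonneg_prefix_sum_pow)
    have "dominates n C (\<lambda>i. max (b i) 0) b"
      unfolding dominates_def
    proof (intro allI impI conjI)
      fix i assume i: "i < n"
      have nn: "0 \<le> (\<Sum>l<i. max (b l) 0)"
        by (simp add: sum_nonneg)
      show "max (b i) 0 - C * (\<Sum>l<i. max (b l) 0) \<le> b i"
      proof (cases "0 \<le> b i")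
        case True
        thus ?thesis using mult_nonneg_nonneg [OF C nn] by simp
      next
        case False
        then obtain k where k: "0 < b k" "\<And>j. j < k \<Longrightarrow> b j = 0"
          using b by (auto simp: lex_nonneg_def)
        have "k < i"
          using k False by (metis less_le_not_le linorder_neqE_nat order.refl)
        hence "max (b k) 0 \<le> (\<Sum>l<i. max (b l) 0)"
          by (intro member_le_sum) auto
        hence "C * b k \<le> C * (\<Sum>l<i. max (b l) 0)"
          using C by (intro mult_left_mono) auto
        moreover have "c' * 1 \<le> c' * (of_nat d * b k)"
          using Ints_pos_ge_inverse [OF d exponents_prefix_sum_pow [OF shifted_cone_exponents [OF a]]] k(1) c'(1)
          unfolding b_def by (intro mult_left_mono) auto
        moreover have "c' * (of_nat d * b k) = C * b k"
          by (simp add: C_def)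
        moreover have "- c \<le> b i"
          using a i by (simp add: shifted_cone_def b_def)
        ultimately have "- b i \<le> C * (\<Sum>l<i. max (b l) 0)"
          using c'(2) by linarith
        thus ?thesis
          using False by simp
      qed
    qed simp
    hence "0 \<le> (prefix_sum ^^ K) b i" if "i < n" for i
      using K that by blast
    thus ?thesis
      using a by (simp add: shifted_cone_def b_def funpow_add)
  qed
  thus ?thesis by blast
qed

section \<open>Series supported in translated cones\<close>

definition cone_laurent :: "nat \<Rightarrow> nat \<Rightarrow> 'k::field lseries set" where
  "cone_laurent n d = {x. \<exists>N c. lsupp x \<subseteq> shifted_cone n d N c}"

lemma cone_laurentI: "lsupp x \<subseteq> shifted_cone n d N c \<Longrightarrow> x \<in> cone_laurent n d"
  unfolding cone_laurent_def by blast

lemma cone_laurent_lsupp: "x \<in> cone_laurent n d \<Longrightarrow> lsupp x \<in> laurent_supports n d"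
  unfolding cone_laurent_def using shifted_cone_in_laurent_supports laurent_supports_subset by blast

lemma lcoeff_Abs_shifted_cone:
  assumes "0 < d" "\<And>a. f a \<noteq> 0 \<Longrightarrow> a \<in> shifted_cone n d N c"
  shows "lcoeff (Abs_lseries f) = f"
  using assms(1) shifted_cone_in_laurent_supports assms(2) by (rule lcoeff_Abs)

lemma cone_laurent_common_shifted_cone:
  assumes "x \<in> cone_laurent n d" "y \<in> cone_laurent n d"
  shows "\<exists>N c. 0 \<le> c \<and> lsupp x \<subseteq> shifted_cone n d N c \<and> lsupp y \<subseteq> shifted_cone n d N c"
proof -
  obtain N1 c1 N2 c2 where *: "lsupp x \<subseteq> shifted_cone n d N1 c1" "lsupp y \<subseteq> shifted_cone n d N2 c2"
    using assms by (auto simp: cone_laurent_def)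
  obtain N c where "0 \<le> c" "shifted_cone n d N1 c1 \<subseteq> shifted_cone n d N c" "shifted_cone n d N2 c2 \<subseteq> shifted_cone n d N c"
    using shifted_cone_directed by blast
  with * show ?thesis by blast
qed

lemma lsupp_simps:
  "lsupp 0 = {}" "lsupp 1 = {0}" "lsupp (- x) = lsupp x"
  by (auto simp: lsupp_def lcoeff_0 lcoeff_1 lcoeff_uminus zero_fun_def)

lemma lsupp_add: "lsupp (x + y) \<subseteq> lsupp x \<union> lsupp y"
  by (auto simp: lsupp_def lcoeff_add)

lemma cone_laurent_0: "0 \<in> cone_laurent n d"
  by (simp add: cone_laurent_def lsupp_simps)

lemma cone_laurent_1: "1 \<in> cone_laurent n d"
  by (rule cone_laurentI [of _ _ _ 0 0]) (simp add: lsupp_simps shifted_cone_zero)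

lemma cone_laurent_uminus: "x \<in> cone_laurent n d \<Longrightarrow> - x \<in> cone_laurent n d"
  by (simp add: cone_laurent_def lsupp_simps)

lemma cone_laurent_add:
  assumes "x \<in> cone_laurent n d" "y \<in> cone_laurent n d"
  shows "x + y \<in> cone_laurent n d"
proof -
  obtain N c where "lsupp x \<subseteq> shifted_cone n d N c" "lsupp y \<subseteq> shifted_cone n d N c"
    using cone_laurent_common_shifted_cone [OF assms] by blast
  thus ?thesis
    using lsupp_add [of x y] by (intro cone_laurentI [of _ _ _ N c]) blast
qed

lemma cone_laurent_mult:
  assumes "x \<in> cone_laurent n d" "y \<in> cone_laurent n d"
  shows "x * y \<in> cone_laurent n d"
proof -
  obtain N c where *: "lsupp x \<subseteq> shifted_cone n d N c" "lsupp y \<subseteq> shifted_cone n d N c"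
    using cone_laurent_common_shifted_cone [OF assms] by blast
  show ?thesis
  proof (rule cone_laurentI)
    show "lsupp (x * y) \<subseteq> shifted_cone n d N (c + c)"
    proof
      fix a assume "a \<in> lsupp (x * y)"
      hence "a \<in> lsupp x + lsupp y"
        using lsupp_mult by blast
      thus "a \<in> shifted_cone n d N (c + c)"
        using * by (elim set_plus_elim) (blast intro: shifted_cone_add)
    qed
  qed
qed

lemma cone_laurent_refine: "x \<in> cone_laurent n d \<Longrightarrow> x \<in> cone_laurent n (d * e)"
  unfolding cone_laurent_def using shifted_cone_refine by blast

section \<open>Monomials\<close>

definition lmonom :: "(nat \<Rightarrow> rat) \<Rightarrow> 'k \<Rightarrow> 'k::field lseries" where
  "lmonom a k = Abs_lseries (\<lambda>b. if b = a then k else 0)"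

lemma lcoeff_lmonom:
  assumes "0 < d" "a \<in> exponents n d"
  shows "lcoeff (lmonom a k) = (\<lambda>b. if b = a then k else 0)"
proof -
  obtain c where "a \<in> shifted_cone n d 0 c"
    using exponents_shifted_cone [OF assms(2)] by blast
  thus ?thesis
    unfolding lmonom_def using assms(1) by (intro lcoeff_Abs_shifted_cone [of d _ n 0 c]) (auto split: if_splits)
qed

lemma cone_laurent_lmonom:
  assumes "0 < d" "a \<in> exponents n d"
  shows "lmonom a k \<in> cone_laurent n d"
proof -
  obtain c where "a \<in> shifted_cone n d 0 c"
    using exponents_shifted_cone [OF assms(2)] by blast
  thus ?thesis
    by (intro cone_laurentI [of _ _ _ 0 c]) (auto simp: lsupp_def lcoeff_lmonom [OF assms] split: if_splits)
qed

lemma lcoeff_lmonom_mult: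
  assumes "0 < d" "a \<in> exponents n d"
  shows "lcoeff (lmonom a k * x) c = k * lcoeff x (c - a)"
proof -
  have "lcoeff (lmonom a k * x) c = (\<Sum>b\<in>{a}. lcoeff (lmonom a k) b * lcoeff x (c - b))"
    by (rule lcoeff_mult_eq_sum) (auto simp: lcoeff_lmonom [OF assms] split: if_splits)
  thus ?thesis
    by (simp add: lcoeff_lmonom [OF assms])
qed

lemma lmonom_mult:
  assumes "0 < d" "a \<in> exponents n d" "b \<in> exponents n d"
  shows "lmonom a k * lmonom b l = lmonom (a + b) (k * l)"
proof (rule lseries_eqI)
  fix c
  have "c - a = b \<longleftrightarrow> c = a + b"
    by (simp only: diff_eq_eq add.commute)
  thus "lcoeff (lmonom a k * lmonom b l) c = lcoeff (lmonom (a + b) (k * l)) c"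
    by (simp only: lcoeff_lmonom_mult [OF assms(1,2)] lcoeff_lmonom [OF assms(1,3)]
        lcoeff_lmonom [OF assms(1) exponents_add [OF assms(2,3)]]) simp
qed

lemma lmonom_0_1: "lmonom 0 1 = 1"
  by (rule lseries_eqI)
    (simp only: lcoeff_lmonom [OF zero_less_one exponents_zero] lcoeff_1 zero_fun_def [symmetric])

lemma lmonom_inverse:
  assumes "0 < d" "a \<in> exponents n d" "k \<noteq> 0"
  shows "lmonom a k * lmonom (- a) (1 / k) = 1"
  by (subst lmonom_mult [OF assms(1,2) exponents_uminus [OF assms(2)]])
    (use assms(3) in \<open>simp add: lmonom_0_1\<close>)

lemma lmonom_power:
  assumes "0 < d" "a \<in> exponents n d"
  shows "lmonom a (1::'k::field) ^ m = lmonom (\<lambda>i. of_nat m * a i) 1 \<and> (\<lambda>i. of_nat m * a i) \<in> exponents n d"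
proof (induction m)
  case 0
  have "(\<lambda>i. of_nat 0 * a i) = 0"
    by (simp add: zero_fun_def)
  thus ?case
    by (simp only: power_0 lmonom_0_1 exponents_zero simp_thms)
next
  case (Suc m)
  have *: "a + (\<lambda>i. of_nat m * a i) = (\<lambda>i. of_nat (Suc m) * a i)"
    by (auto simp: algebra_simps)
  have "lmonom a (1::'k) ^ Suc m = lmonom a 1 * lmonom (\<lambda>i. of_nat m * a i) 1"
    unfolding power_Suc using Suc by (intro arg_cong2 [where f = "(*)"]) auto
  also have "\<dots> = lmonom (\<lambda>i. of_nat (Suc m) * a i) 1"
    using lmonom_mult [OF assms(1,2) conjunct2 [OF Suc], of 1 1] by (simp only: * mult_1)
  finally show ?case
    using exponents_add [OF assms(2) conjunct2 [OF Suc]] by (simp only: * simp_thms)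
qed

section \<open>Inverses\<close>

text \<open>
  The numbers \<open>d (prefix_sum\<^sup>M a)\<^sub>i\<close> are the coordinates of a lattice point \<open>a\<close> with respect to
  the generators of the cone, so the weight is the total degree of the corresponding monomial in the
  power series ring \<open>k[[\<Gamma>,d]]\<close>.
\<close>

definition weight :: "nat \<Rightarrow> nat \<Rightarrow> nat \<Rightarrow> (nat \<Rightarrow> rat) \<Rightarrow> nat" where
  "weight n d M a = nat \<lfloor>of_nat d * (\<Sum>i<n. (prefix_sum ^^ M) a i)\<rfloor>"

lemma weight_less:
  assumes d: "0 < d" and a: "a \<in> shifted_cone n d M 0" "a \<noteq> 0" and b: "b \<in> shifted_cone n d M 0"
  shows "weight n d M b < weight n d M (a + b)"
proof -
  let ?S = "\<lambda>a. \<Sum>i<n. (prefix_sum ^^ M) a i"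
  have nn: "0 \<le> (prefix_sum ^^ M) x i" if "x \<in> shifted_cone n d M 0" "i < n" for x i
    using that by (simp add: shifted_cone_def)
  have "\<not> (\<forall>i<n. (prefix_sum ^^ M) a i = 0)"
  proof
    assume "\<forall>i<n. (prefix_sum ^^ M) a i = 0"
    hence "\<forall>i<n. a i = 0"
      by (rule prefix_sum_pow_eq_0_iff [THEN iffD1])
    moreover have "a i = 0" if "n \<le> i" for i
      using shifted_cone_exponents [OF a(1)] that by (simp add: exponents_def)
    ultimately have "a i = 0" for i
      by (cases "i < n") auto
    thus False
      using a(2) by auto
  qed
  then obtain i where i: "i < n" "(prefix_sum ^^ M) a i \<noteq> 0"
    by blast
  hence "0 < (prefix_sum ^^ M) a i"
    using nn [OF a(1)] by (simp add: less_le)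
  moreover have "(prefix_sum ^^ M) a i \<le> ?S a"
    using i(1) nn [OF a(1)] by (intro member_le_sum) auto
  ultimately have "0 < ?S a"
    by linarith
  moreover have "of_nat d * ?S a \<in> \<int>"
    using exponents_prefix_sum_pow [OF shifted_cone_exponents [OF a(1)]] by (auto simp: sum_distrib_left)
  ultimately have "1 \<le> of_nat d * ?S a"
    using d by (intro Ints_pos_ge_inverse)
  moreover have "?S (a + b) = ?S a + ?S b"
    by (simp add: prefix_sum_pow_add sum.distrib)
  ultimately have "of_nat d * ?S b + 1 \<le> of_nat d * ?S (a + b)"
    by (simp add: distrib_left)
  moreover have "0 \<le> of_nat d * ?S b"
    by (intro mult_nonneg_nonneg sum_nonneg) (auto intro: nn [OF b])
  ultimately show ?thesis
    unfolding weight_def by linarith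
qed

lemma cone_decomposition_zero:
  assumes "0 < d" "a \<in> shifted_cone n d M 0" "- a \<in> shifted_cone n d M 0"
  shows "a = 0"
proof (rule ccontr)
  assume "a \<noteq> 0"
  hence "weight n d M (- a) < weight n d M (a + - a)" "weight n d M a < weight n d M (- a + a)"
    using weight_less [OF assms(1,2) _ assms(3)] weight_less [OF assms(1,3) _ assms(2)]
    by (simp_all only: neg_equal_0_iff_equal not_False_eq_True simp_thms)
  moreover have "weight n d M 0 = 0"
    by (simp add: weight_def prefix_sum_pow_zero)
  ultimately show False
    by (simp only: right_minus)
qed

lemma finite_cone_decompositions:
  "0 < d \<Longrightarrow> finite {b \<in> shifted_cone n d M 0. a - b \<in> shifted_cone n d M 0}"
  by (rule laurent_supports_finite_decompositions [of d _ n]) (auto intro: shifted_cone_in_laurent_supports)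

text \<open>
  The equation for the coefficient of \<open>u * y\<close> at \<open>a \<noteq> 0\<close> expresses the coefficient of \<open>y\<close> at
  \<open>a\<close> by those at \<open>a - b\<close> with \<open>b \<noteq> 0\<close>, which have smaller weight.
\<close>

lemma cone_unit_inverse:
  fixes u :: "'k::field lseries"
  assumes d: "0 < d" and u: "lsupp u \<subseteq> shifted_cone n d M 0" "lcoeff u 0 = 1"
  shows "\<exists>y. lsupp y \<subseteq> shifted_cone n d M 0 \<and> u * y = 1"
proof -
  let ?L = "shifted_cone n d M 0"
  let ?D = "\<lambda>a. {b \<in> ?L. a - b \<in> ?L}"
  have fin: "finite (?D a)" for a
    using d by (rule finite_cone_decompositions)
  define F where "F f a = (if a \<notin> ?L then 0 else if a = 0 then 1
    else - (\<Sum>b\<in>?D a - {0}. lcoeff u b * f (a - b)))" for f :: "(nat \<Rightarrow> rat) \<Rightarrow> 'k" and a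
  have "\<exists>f. \<forall>a. f a = F f a"
  proof (rule dependent_wf_choice)
    show "wf (Wellfounded.measure (weight n d M))"
      by simp
    fix f g :: "(nat \<Rightarrow> rat) \<Rightarrow> 'k" and a r
    assume fg: "f b = g b" if "(b, a) \<in> Wellfounded.measure (weight n d M)" for b
    have "f (a - b) = g (a - b)" if b: "b \<in> ?D a - {0}" for b
    proof (rule fg)
      have "weight n d M (a - b) < weight n d M (b + (a - b))"
        using b d by (intro weight_less) auto
      thus "(a - b, a) \<in> Wellfounded.measure (weight n d M)"
        by simp
    qed
    hence "(\<Sum>b\<in>?D a - {0}. lcoeff u b * f (a - b)) = (\<Sum>b\<in>?D a - {0}. lcoeff u b * g (a - b))"
      by (intro sum.cong refl arg_cong2 [where f = "(*)"])
    hence "F f a = F g a"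
      unfolding F_def by (simp only:)
    thus "(r = F f a) = (r = F g a)"
      by simp
  qed blast
  then obtain f where f: "\<And>a. f a = F f a"
    by blast
  have f0: "f a = 0" if "a \<notin> ?L" for a
    using f [of a] that by (simp add: F_def)
  define y where "y = Abs_lseries f"
  have y: "lcoeff y = f"
    unfolding y_def using d f0 by (intro lcoeff_Abs_shifted_cone [of d f n M 0]) auto
  have "lcoeff (u * y) a = lcoeff 1 a" for a
  proof -
    have eq: "lcoeff (u * y) a = (\<Sum>b\<in>?D a. lcoeff u b * f (a - b))"
      using fin unfolding y [symmetric]
      by (rule lcoeff_mult_eq_sum) (use u(1) f0 in \<open>auto simp: lsupp_def y\<close>)
    have z: "0 \<in> ?L"
      by (simp add: shifted_cone_zero)
    consider "a \<notin> ?L" | "a = 0" | "a \<in> ?L" "a \<noteq> 0"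
      by blast
    thus ?thesis
    proof cases
      case 1
      have "?D a = {}"
      proof -
        have "b + (a - b) \<in> ?L" if "b \<in> ?D a" for b
          using that shifted_cone_add [of b n d M 0 "a - b" 0] by simp
        thus ?thesis
          using 1 by auto
      qed
      moreover have "a \<noteq> 0"
        using 1 z by blast
      ultimately show ?thesis
        unfolding eq by (simp only: sum.empty lcoeff_1 zero_fun_def [symmetric] if_False)
    next
      case 2
      have "?D a = {0}"
        unfolding 2 using cone_decomposition_zero [OF d] z by auto
      moreover have "f 0 = 1"
        using f [of 0] z by (simp add: F_def)
      ultimately show ?thesis
        unfolding eq using 2 u(2) by (simp add: lcoeff_1 zero_fun_def)
    next
      case 3
      have "0 \<in> ?D a"
        using 3 z by simp
      hence "lcoeff (u * y) a = lcoeff u 0 * f (a - 0) + (\<Sum>b\<in>?D a - {0}. lcoeff u b * f (a - b))"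
        unfolding eq using fin by (intro sum.remove)
      moreover have "f a = - (\<Sum>b\<in>?D a - {0}. lcoeff u b * f (a - b))"
        unfolding f [of a] using 3 by (simp only: F_def if_False not_not simp_thms)
      ultimately have "lcoeff (u * y) a = 0"
        by (simp only: u(2) diff_zero mult_1 left_minus)
      thus ?thesis
        using 3 by (simp add: lcoeff_1 zero_fun_def)
    qed
  qed
  hence "u * y = 1"
    by (rule lseries_eqI)
  moreover have "lsupp y \<subseteq> ?L"
    using f0 by (auto simp: lsupp_def y)
  ultimately show ?thesis
    by blast
qed

text \<open>
  The valuation ring of the lexicographic valuation is the union of the power series rings of the
  cones.
\<close>

lemma lex_nonneg_in_cone:
  assumes "0 < d" "x \<in> cone_laurent n d" "\<And>a. a \<in> lsupp x \<Longrightarrow> lex_nonneg a"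
  shows "\<exists>M. lsupp x \<subseteq> shifted_cone n d M 0"
proof -
  obtain N c where *: "lsupp x \<subseteq> shifted_cone n d N c"
    using assms(2) by (auto simp: cone_laurent_def)
  obtain M where "\<And>a. a \<in> shifted_cone n d N c \<Longrightarrow> lex_nonneg a \<Longrightarrow> a \<in> shifted_cone n d M 0"
    using lex_nonneg_shifted_cone_in_cone [OF assms(1)] by blast
  thus ?thesis
    using * assms(3) by blast
qed

lemma cone_laurent_exponents: "x \<in> cone_laurent n d \<Longrightarrow> a \<in> lsupp x \<Longrightarrow> a \<in> exponents n d"
  unfolding cone_laurent_def using shifted_cone_exponents by blast

text \<open>
  Division by the leading term leaves a series of value \<open>0\<close> with constant term \<open>1\<close>, which is a
  unit in one of the power series rings.
\<close>

lemma cone_laurent_inverse: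
  assumes d: "0 < d" and x: "x \<in> cone_laurent n d" "x \<noteq> 0"
  shows "\<exists>y\<in>cone_laurent n d. x * y = 1"
proof -
  have "lsupp x \<noteq> {}"
    using x(2) lseries_eqI [of x 0] by (auto simp: lsupp_def lcoeff_0)
  then obtain m where m: "m \<in> lsupp x" "\<And>a. a \<in> lsupp x \<Longrightarrow> lex_nonneg (a - m)"
    using laurent_supports_lex_minimum [OF d cone_laurent_lsupp [OF x(1)]] by blast
  let ?k = "lcoeff x m"
  have k: "?k \<noteq> 0"
    using m(1) by (simp add: lsupp_def)
  have me: "- m \<in> exponents n d"
    using cone_laurent_exponents [OF x(1) m(1)] by (rule exponents_uminus)
  define t where "t = lmonom (- m) (1 / ?k)"
  have tK: "t \<in> cone_laurent n d"
    unfolding t_def using d me by (rule cone_laurent_lmonom)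
  have tx: "lcoeff (t * x) a = 1 / ?k * lcoeff x (a + m)" for a
    unfolding t_def lcoeff_lmonom_mult [OF d me] by (simp only: diff_minus_eq_add)
  have "lex_nonneg a" if "a \<in> lsupp (t * x)" for a
  proof -
    have "a + m \<in> lsupp x"
      using that by (simp add: lsupp_def tx)
    from m(2) [OF this] show ?thesis
      by (simp only: add_diff_cancel)
  qed
  then obtain M where M: "lsupp (t * x) \<subseteq> shifted_cone n d M 0"
    using lex_nonneg_in_cone [OF d cone_laurent_mult [OF tK x(1)]] by blast
  moreover have "lcoeff (t * x) 0 = 1"
    using k by (simp add: tx)
  ultimately obtain y where y: "lsupp y \<subseteq> shifted_cone n d M 0" "t * x * y = 1"
    using cone_unit_inverse [OF d] by blast
  have "t * y \<in> cone_laurent n d"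
    using tK cone_laurentI [OF y(1)] by (rule cone_laurent_mult)
  moreover have "x * (t * y) = 1"
    using y(2) by (simp add: mult_ac)
  ultimately show ?thesis
    by blast
qed

section \<open>Hensel's lemma for cone series\<close>

text \<open>
  Layers turn a polynomial whose coefficients are series into a series whose coefficients are
  polynomials over \<open>k\<close>.  In this form a factorization is found one exponent at a time.
\<close>

definition layer :: "'k::field lseries poly \<Rightarrow> (nat \<Rightarrow> rat) \<Rightarrow> 'k poly" where
  "layer p a = map_poly (\<lambda>x. lcoeff x a) p"

lemma coeff_layer: "Polynomial.coeff (layer p a) i = lcoeff (Polynomial.coeff p i) a"
  by (simp add: layer_def coeff_map_poly lcoeff_0)

lemma layer_eqI:
  assumes "\<And>a. layer p a = layer q a"
  shows "p = q"
proof (intro poly_eqI lseries_eqI)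
  fix i a
  show "lcoeff (Polynomial.coeff p i) a = lcoeff (Polynomial.coeff q i) a"
    unfolding coeff_layer [symmetric] assms ..
qed

lemma lcoeff_sum: "lcoeff (sum f A) a = (\<Sum>i\<in>A. lcoeff (f i) a)"
  by (induction A rule: infinite_finite_induct) (simp_all add: lcoeff_0 lcoeff_add)

lemma layer_mult:
  assumes "0 < d" "\<And>i. lsupp (Polynomial.coeff p i) \<subseteq> shifted_cone n d M 0"
    "\<And>i. lsupp (Polynomial.coeff q i) \<subseteq> shifted_cone n d M 0"
  shows "layer (p * q) a =
    (\<Sum>b | b \<in> shifted_cone n d M 0 \<and> a - b \<in> shifted_cone n d M 0. layer p b * layer q (a - b))"
proof (rule poly_eqI)
  fix i
  let ?D = "{b \<in> shifted_cone n d M 0. a - b \<in> shifted_cone n d M 0}"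
  have *: "lcoeff (Polynomial.coeff p j * Polynomial.coeff q l) a =
      (\<Sum>b\<in>?D. lcoeff (Polynomial.coeff p j) b * lcoeff (Polynomial.coeff q l) (a - b))" for j l
  proof (rule lcoeff_mult_eq_sum)
    show "finite ?D"
      using assms(1) by (rule finite_cone_decompositions)
    fix b assume "lcoeff (Polynomial.coeff p j) b \<noteq> 0" "lcoeff (Polynomial.coeff q l) (a - b) \<noteq> 0"
    thus "b \<in> ?D"
      using subsetD [OF assms(2) [of j], of b] subsetD [OF assms(3) [of l], of "a - b"]
      by (simp only: lsupp_iff mem_Collect_eq not_False_eq_True)
  qed
  have "Polynomial.coeff (layer (p * q) a) i =
      (\<Sum>j\<le>i. \<Sum>b\<in>?D. lcoeff (Polynomial.coeff p j) b * lcoeff (Polynomial.coeff q (i - j)) (a - b))"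
    by (simp only: coeff_layer coeff_mult lcoeff_sum *)
  also have "\<dots> = (\<Sum>b\<in>?D. \<Sum>j\<le>i. lcoeff (Polynomial.coeff p j) b * lcoeff (Polynomial.coeff q (i - j)) (a - b))"
    by (rule sum.swap)
  also have "\<dots> = Polynomial.coeff (\<Sum>b\<in>?D. layer p b * layer q (a - b)) i"
    by (simp only: coeff_layer coeff_mult coeff_sum)
  finally show "Polynomial.coeff (layer (p * q) a) i =
      Polynomial.coeff (\<Sum>b\<in>?D. layer p b * layer q (a - b)) i" .
qed

text \<open>
  Multiplying the Bezout relation by \<open>q\<close> solves the equation without degree bounds.  Reducing the
  cofactor of \<open>h\<close> modulo \<open>g\<close> bounds its degree, and comparing degrees in the equation then bounds
  the other cofactor.
\<close>

lemma coprime_degree_split: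
  fixes g h q u v :: "'k::field poly"
  assumes uv: "u * g + v * h = 1"
    and pos: "0 < Polynomial.degree g" "0 < Polynomial.degree h"
    and q: "Polynomial.degree q < Polynomial.degree g + Polynomial.degree h"
  shows "\<exists>t s. Polynomial.degree t < Polynomial.degree g \<and>
    Polynomial.degree s < Polynomial.degree h \<and> g * s + h * t = q"
proof -
  define t where "t = (v * q) mod g"
  define s where "s = u * q + h * ((v * q) div g)"
  have g: "g \<noteq> 0" using pos by auto
  have t: "Polynomial.degree t < Polynomial.degree g"
    using degree_mod_less [OF g, of "v * q"] pos by (auto simp: t_def)
  have "g * s + h * t = u * g * q + h * ((v * q) div g * g + (v * q) mod g)"
    by (simp only: s_def t_def algebra_simps)
  also have "\<dots> = (u * g + v * h) * q"
    by (simp only: div_mult_mod_eq) (simp only: algebra_simps)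
  finally have eq: "g * s + h * t = q"
    using uv by simp
  have "Polynomial.degree s < Polynomial.degree h"
  proof (cases "s = 0")
    case False
    have "Polynomial.degree (h * t) < Polynomial.degree g + Polynomial.degree h"
      using degree_mult_le [of h t] t by linarith
    hence "Polynomial.degree (q - h * t) < Polynomial.degree g + Polynomial.degree h"
      using q by (rule degree_diff_less [rotated])
    moreover have "g * s = q - h * t"
      unfolding eq [symmetric] by simp
    ultimately show ?thesis
      using degree_mult_eq [OF g False] by simp
  qed (use pos in simp)
  with t eq show ?thesis by blast
qed

lemma linear_power_coprime:
  fixes h :: "'k::field poly"
  assumes "poly h r \<noteq> 0"
  shows "\<exists>u v. u * [:- r, 1:] ^ e + v * h = 1"
proof (induction e)
  case 0
  show ?case
    by (intro exI [of _ 1] exI [of _ 0]) simp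
next
  case (Suc e)
  let ?l = "[:- r, 1:]"
  obtain u v where uv: "u * ?l ^ e + v * h = 1"
    using Suc by blast
  let ?c = "[:1 / poly h r:]"
  have c: "?c * [:poly h r:] = 1"
    using assms by (simp add: one_pCons)
  have h: "h = ?l * synthetic_div h r + [:poly h r:]"
    using synthetic_div_correct' [of r h] by simp
  have ch: "?c * h = ?c * (?l * synthetic_div h r) + 1"
    by (subst h) (simp only: distrib_left c)
  have 1: "1 = - (?c * synthetic_div h r) * ?l + ?c * h"
    unfolding ch by (simp only: mult_minus_left mult_minus_right mult_ac minus_add_cancel)
  let ?w = "- (?c * synthetic_div h r)"
  have "1 = u * ?l ^ e * (?w * ?l + ?c * h) + v * h"
    using uv by (simp only: 1 [symmetric] mult_1_right)
  also have "\<dots> = (u * ?w) * ?l ^ Suc e + (u * ?l ^ e * ?c + v) * h"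
    by (simp only: power_Suc algebra_simps)
  finally show ?case
    by metis
qed

lemma ex_poly_coeffs: "\<exists>p. \<forall>i. Polynomial.coeff p i = (if i \<le> m then c i else 0)"
  by (rule exI [of _ "Poly (map c [0..<Suc m])"])
    (auto simp: coeff_Poly_eq nth_default_def simp del: upt_Suc)

text \<open>
  At an exponent \<open>a \<noteq> 0\<close>, the unknown layers \<open>t\<close> of \<open>G\<close> and \<open>s\<close> of \<open>H\<close> enter the equation
  \<open>p = G * H\<close> through \<open>g * s + h * t\<close> only, and the other terms are products of layers of smaller
  weight.  As \<open>g\<close> and \<open>h\<close> are coprime, the equation has a solution with \<open>t\<close> of degree less than
  \<open>g\<close>, which keeps \<open>G\<close> monic of the degree of \<open>g\<close>.
\<close>

lemma hensel_factorization:
  fixes p :: "'k::field lseries poly"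
  assumes d: "0 < d"
    and p: "\<And>i. lsupp (Polynomial.coeff p i) \<subseteq> shifted_cone n d M 0"
    and deg: "Polynomial.degree p \<le> Polynomial.degree g + Polynomial.degree h"
    and lead: "Polynomial.coeff p (Polynomial.degree g + Polynomial.degree h) = 1"
    and gh: "layer p 0 = g * h" "u * g + v * h = 1"
    and g: "0 < Polynomial.degree g" "Polynomial.coeff g (Polynomial.degree g) = 1" and h: "0 < Polynomial.degree h"
  shows "\<exists>G H. p = G * H \<and> Polynomial.degree G = Polynomial.degree g \<and> Polynomial.coeff G (Polynomial.degree G) = 1 \<and>
    (\<forall>i. lsupp (Polynomial.coeff G i) \<subseteq> shifted_cone n d M 0)"
proof -
  let ?L = "shifted_cone n d M 0" and ?dg = "Polynomial.degree g" and ?dh = "Polynomial.degree h"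
  let ?D = "\<lambda>a. {b \<in> ?L. a - b \<in> ?L}"
  let ?R = "Wellfounded.measure (weight n d M)"
  have fin: "finite (?D a)" for a
    using d by (rule finite_cone_decompositions)
  have smaller: "(b, a) \<in> ?R \<and> (a - b, a) \<in> ?R" if b: "b \<in> ?D a - {0, a}" for a b
  proof -
    have "weight n d M (a - b) < weight n d M (b + (a - b))"
      using b d by (intro weight_less) auto
    moreover have "weight n d M b < weight n d M (a - b + b)"
      using b d by (intro weight_less) auto
    moreover have "b + (a - b) = a" "a - b + b = a"
      by simp_all
    ultimately show ?thesis
      by (simp only: in_measure simp_thms)
  qed
  define S where "S f a = (\<Sum>b\<in>?D a - {0, a}. fst (f b) * snd (f (a - b)))"
    for f :: "(nat \<Rightarrow> rat) \<Rightarrow> 'k poly \<times> 'k poly" and a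
  \<comment> \<open>\<open>Q f a r\<close>: the pair \<open>r\<close> is admissible as the layers of the two factors at \<open>a\<close>, given \<open>f\<close> at smaller weights\<close>
  define Q where "Q f a r \<longleftrightarrow> (if a \<notin> ?L then r = (0, 0) else if a = 0 then r = (g, h)
      else Polynomial.degree (fst r) < ?dg \<and> Polynomial.degree (snd r) < ?dh \<and>
        g * snd r + h * fst r = layer p a - S f a)"
    for f :: "(nat \<Rightarrow> rat) \<Rightarrow> 'k poly \<times> 'k poly" and a r
  have "\<exists>f. \<forall>a. Q f a (f a)"
  proof (rule dependent_wf_choice)
    show "wf ?R" by simp
  next
    fix f f' :: "(nat \<Rightarrow> rat) \<Rightarrow> 'k poly \<times> 'k poly" and a r
    assume "f b = f' b" if "(b, a) \<in> ?R" for b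
    hence "S f a = S f' a"
      unfolding S_def using smaller
      by (intro sum.cong refl arg_cong2 [where f = "(*)"] arg_cong [where f = fst] arg_cong [where f = snd])
        blast+
    thus "Q f a r = Q f' a r"
      unfolding Q_def by (simp only:)
  next
    fix a f
    assume IH: "Q f b (f b)" if "(b, a) \<in> ?R" for b
    consider "a \<notin> ?L" | "a = 0" "a \<in> ?L" | "a \<in> ?L" "a \<noteq> 0"
      by blast
    thus "\<exists>r. Q f a r"
    proof cases
      case 3
      have fb: "Polynomial.degree (fst (f b)) < ?dg \<and> Polynomial.degree (snd (f b)) < ?dh"
        if "(b, a) \<in> ?R" "b \<in> ?L" "b \<noteq> 0" for b
        using IH [OF that(1)] that(2,3) unfolding Q_def by (simp only: not_not if_False simp_thms)
      have "Polynomial.degree (fst (f b) * snd (f (a - b))) < ?dg + ?dh" if b: "b \<in> ?D a - {0, a}" for b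
      proof -
        have "a - b \<noteq> 0"
          using b by auto
        hence "Polynomial.degree (fst (f b)) < ?dg" "Polynomial.degree (snd (f (a - b))) < ?dh"
          using fb smaller [OF b] b by blast+
        thus ?thesis
          using degree_mult_le [of "fst (f b)" "snd (f (a - b))"] by linarith
      qed
      hence "Polynomial.degree (S f a) < ?dg + ?dh"
        unfolding S_def using g(1) by (intro degree_sum_less) auto
      moreover have "Polynomial.degree (layer p a) < ?dg + ?dh"
      proof -
        have "Polynomial.degree (layer p a) \<le> ?dg + ?dh"
          using deg by (intro degree_le) (auto simp: coeff_layer coeff_eq_0 lcoeff_0)
        moreover have "Polynomial.coeff (layer p a) (?dg + ?dh) = 0"
          using 3(2) by (simp add: coeff_layer lead lcoeff_1 zero_fun_def)
        ultimately show ?thesis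
          using g(1) by (metis add_gr_0 degree_0 leading_coeff_0_iff order_le_less)
      qed
      ultimately have "Polynomial.degree (layer p a - S f a) < ?dg + ?dh"
        by (intro degree_diff_less)
      then obtain t s where "Polynomial.degree t < ?dg" "Polynomial.degree s < ?dh"
          "g * s + h * t = layer p a - S f a"
        using coprime_degree_split [OF gh(2) g(1) h] by blast
      hence "Q f a (t, s)"
        using 3 by (simp add: Q_def)
      thus ?thesis by blast
    qed (auto simp: Q_def)
  qed
  then obtain f where f: "\<And>a. Q f a (f a)"
    by blast
  have fnot: "f a = (0, 0)" if "a \<notin> ?L" for a
    using f [of a] that by (simp add: Q_def)
  have zL: "0 \<in> ?L"
    by (simp add: shifted_cone_zero)
  have f0: "f 0 = (g, h)"
    using f [of 0] zL by (simp add: Q_def)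
  have fpos: "Polynomial.degree (fst (f a)) < ?dg \<and> Polynomial.degree (snd (f a)) < ?dh \<and>
      g * snd (f a) + h * fst (f a) = layer p a - S f a" if "a \<in> ?L" "a \<noteq> 0" for a
    using f [of a] that unfolding Q_def by (simp only: not_not if_False simp_thms)
  have degf: "Polynomial.degree (fst (f a)) \<le> ?dg \<and> Polynomial.degree (snd (f a)) \<le> ?dh" for a
    using fnot [of a] f0 fpos [of a] by (cases "a \<in> ?L"; cases "a = 0") auto
  obtain G where G: "\<And>i. Polynomial.coeff G i =
      (if i \<le> ?dg then Abs_lseries (\<lambda>a. Polynomial.coeff (fst (f a)) i) else 0)"
    using ex_poly_coeffs [of ?dg "\<lambda>i. Abs_lseries (\<lambda>a. Polynomial.coeff (fst (f a)) i)"] by blast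
  obtain H where H: "\<And>i. Polynomial.coeff H i =
      (if i \<le> ?dh then Abs_lseries (\<lambda>a. Polynomial.coeff (snd (f a)) i) else 0)"
    using ex_poly_coeffs [of ?dh "\<lambda>i. Abs_lseries (\<lambda>a. Polynomial.coeff (snd (f a)) i)"] by blast
  have absG: "lcoeff (Abs_lseries (\<lambda>a. Polynomial.coeff (fst (f a)) i)) a = Polynomial.coeff (fst (f a)) i" for i a
    using lcoeff_Abs_shifted_cone [OF d, of "\<lambda>a. Polynomial.coeff (fst (f a)) i" n M 0] fnot by fastforce
  have absH: "lcoeff (Abs_lseries (\<lambda>a. Polynomial.coeff (snd (f a)) i)) a = Polynomial.coeff (snd (f a)) i" for i a
    using lcoeff_Abs_shifted_cone [OF d, of "\<lambda>a. Polynomial.coeff (snd (f a)) i" n M 0] fnot by fastforce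
  have coefG: "lcoeff (Polynomial.coeff G i) a = Polynomial.coeff (fst (f a)) i" for i a
    using degf [of a] by (auto simp: G absG lcoeff_0 coeff_eq_0)
  have coefH: "lcoeff (Polynomial.coeff H i) a = Polynomial.coeff (snd (f a)) i" for i a
    using degf [of a] by (auto simp: H absH lcoeff_0 coeff_eq_0)
  have layG: "layer G a = fst (f a)" and layH: "layer H a = snd (f a)" for a
    by (rule poly_eqI, simp only: coeff_layer coefG coefH)+
  have suppG: "lsupp (Polynomial.coeff G i) \<subseteq> ?L" for i
  proof
    fix a assume "a \<in> lsupp (Polynomial.coeff G i)"
    hence "Polynomial.coeff (fst (f a)) i \<noteq> 0"
      by (simp only: lsupp_iff coefG not_False_eq_True)
    thus "a \<in> ?L"
      using fnot [of a] by (metis coeff_0 fst_conv)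
  qed
  have suppH: "lsupp (Polynomial.coeff H i) \<subseteq> ?L" for i
  proof
    fix a assume "a \<in> lsupp (Polynomial.coeff H i)"
    hence "Polynomial.coeff (snd (f a)) i \<noteq> 0"
      by (simp only: lsupp_iff coefH not_False_eq_True)
    thus "a \<in> ?L"
      using fnot [of a] by (metis coeff_0 snd_conv)
  qed
  have "layer p a = layer (G * H) a" for a
  proof -
    have GH: "layer (G * H) a = (\<Sum>b\<in>?D a. fst (f b) * snd (f (a - b)))"
      using layer_mult [OF d suppG suppH, of a] by (simp only: layG layH)
    consider "a \<notin> ?L" | "a = 0" "a \<in> ?L" | "a \<in> ?L" "a \<noteq> 0"
      by blast
    thus ?thesis
    proof cases
      case 1
      have "b + (a - b) \<in> ?L" if "b \<in> ?D a" for b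
        using that shifted_cone_add [of b n d M 0 "a - b" 0] by simp
      hence "?D a = {}"
        using 1 by auto
      moreover have "layer p a = 0"
        using 1 p by (intro poly_eqI) (auto simp: coeff_layer lsupp_def)
      ultimately show ?thesis
        unfolding GH by (simp only: sum.empty)
    next
      case 2
      have "?D a = {0}"
        unfolding 2 using cone_decomposition_zero [OF d] zL by auto
      thus ?thesis
        unfolding GH using 2 gh(1) f0 by (simp only: sum.insert finite.emptyI sum.empty) simp
    next
      case 3
      have split: "?D a = insert 0 (insert a (?D a - {0, a}))"
        using 3 zL by auto
      have "(\<Sum>b\<in>?D a. fst (f b) * snd (f (a - b))) =
          fst (f 0) * snd (f (a - 0)) + (fst (f a) * snd (f (a - a)) + S f a)"
        unfolding S_def
        by (subst split, subst sum.insert) (use 3 fin in \<open>auto simp del: fun_diff_def\<close>)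
      also have "\<dots> = g * snd (f a) + h * fst (f a) + S f a"
        by (simp only: diff_zero diff_self f0 fst_conv snd_conv) (simp only: ac_simps)
      also have "\<dots> = layer p a"
        using fpos [OF 3] by simp
      finally show ?thesis
        unfolding GH by simp
    qed
  qed
  hence "p = G * H"
    by (rule layer_eqI)
  moreover have lG: "Polynomial.coeff G ?dg = 1"
  proof (rule lseries_eqI)
    fix a
    consider "a \<notin> ?L" | "a = 0" | "a \<in> ?L" "a \<noteq> 0"
      by blast
    thus "lcoeff (Polynomial.coeff G ?dg) a = lcoeff 1 a"
    proof cases
      case 1
      hence "a \<noteq> 0" using zL by blast
      thus ?thesis
        using fnot [OF 1] by (simp add: coefG lcoeff_1 zero_fun_def)
    next
      case 2
      have "lcoeff (Polynomial.coeff G ?dg) 0 = 1"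
        unfolding coefG f0 using g(2) by simp
      thus ?thesis
        using 2 by (simp add: lcoeff_1 zero_fun_def)
    next
      case 3
      have "Polynomial.coeff (fst (f a)) ?dg = 0"
        using fpos [OF 3] by (simp add: coeff_eq_0)
      thus ?thesis
        using 3 by (simp add: coefG lcoeff_1 zero_fun_def)
    qed
  qed
  moreover have "Polynomial.degree G = ?dg"
  proof (rule antisym)
    show "Polynomial.degree G \<le> ?dg"
      by (rule degree_le) (simp add: G)
    show "?dg \<le> Polynomial.degree G"
      by (rule le_degree) (simp add: lG)
  qed
  ultimately show ?thesis
    using suppG by (intro exI [of _ G] exI [of _ H] conjI allI) simp_all
qed

section \<open>The union over all denominators\<close>

definition cone_laurent_field :: "nat \<Rightarrow> 'k::field lseries set" where
  "cone_laurent_field n = (\<Union>d\<in>{0<..}. cone_laurent n d)"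

lemma cone_laurent_fieldI: "0 < d \<Longrightarrow> x \<in> cone_laurent n d \<Longrightarrow> x \<in> cone_laurent_field n"
  unfolding cone_laurent_field_def by blast

lemma cone_laurent_field_common:
  assumes "finite I" "\<And>i. i \<in> I \<Longrightarrow> f i \<in> cone_laurent_field n"
  shows "\<exists>d>0. \<forall>i\<in>I. f i \<in> cone_laurent n d"
  using assms
proof (induction I rule: finite_induct)
  case empty
  show ?case by blast
next
  case (insert i I)
  then obtain d where d: "0 < d" "\<And>j. j \<in> I \<Longrightarrow> f j \<in> cone_laurent n d"
    by blast
  have "f i \<in> cone_laurent_field n"
    using insert.prems by blast
  then obtain e where e: "0 < e" "f i \<in> cone_laurent n e"
    unfolding cone_laurent_field_def by blast
  have "f j \<in> cone_laurent n (d * e)" if "j \<in> insert i I" for j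
    using that cone_laurent_refine [OF e(2), of d] cone_laurent_refine [OF d(2), of j e]
    by (auto simp: mult.commute)
  thus ?case
    using d(1) e(1) by (intro exI [of _ "d * e"]) simp
qed

lemma cone_laurent_field_pair:
  fixes x y :: "'k::field lseries"
  assumes "x \<in> cone_laurent_field n" "y \<in> cone_laurent_field n"
  shows "\<exists>d>0. x \<in> cone_laurent n d \<and> y \<in> cone_laurent n d"
proof -
  have "\<exists>d>0. \<forall>z\<in>{x, y}. z \<in> cone_laurent n d"
    using assms by (intro cone_laurent_field_common) auto
  thus ?thesis by blast
qed

lemma cone_laurent_field_0: "0 \<in> cone_laurent_field n"
  and cone_laurent_field_1: "1 \<in> cone_laurent_field n"
  using cone_laurent_fieldI [OF zero_less_one cone_laurent_0] cone_laurent_fieldI [OF zero_less_one cone_laurent_1]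
  by blast+

lemma cone_laurent_field_add:
  assumes "x \<in> cone_laurent_field n" "y \<in> cone_laurent_field n"
  shows "x + y \<in> cone_laurent_field n"
  using cone_laurent_field_pair [OF assms] cone_laurent_add cone_laurent_fieldI by blast

lemma cone_laurent_field_mult:
  assumes "x \<in> cone_laurent_field n" "y \<in> cone_laurent_field n"
  shows "x * y \<in> cone_laurent_field n"
  using cone_laurent_field_pair [OF assms] cone_laurent_mult cone_laurent_fieldI by blast

lemma cone_laurent_field_uminus:
  assumes "x \<in> cone_laurent_field n"
  shows "- x \<in> cone_laurent_field n"
  using cone_laurent_field_pair [OF assms assms] cone_laurent_uminus cone_laurent_fieldI by blast

lemma cone_laurent_field_inverse:
  assumes "x \<in> cone_laurent_field n" "x \<noteq> 0"
  shows "\<exists>y\<in>cone_laurent_field n. x * y = 1"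
proof -
  obtain d where d: "0 < d" "x \<in> cone_laurent n d"
    using cone_laurent_field_pair [OF assms(1,1)] by blast
  obtain y where "y \<in> cone_laurent n d" "x * y = 1"
    using cone_laurent_inverse [OF d assms(2)] by blast
  thus ?thesis
    using cone_laurent_fieldI [OF d(1)] by blast
qed

lemma of_nat_cone_laurent_field: "of_nat m \<in> cone_laurent_field n"
  by (induction m) (simp_all add: cone_laurent_field_0 cone_laurent_field_1 cone_laurent_field_add)

lemma lcoeff_of_nat_0: "lcoeff (of_nat m :: 'k::field lseries) 0 = of_nat m"
proof (induction m)
  case (Suc m)
  have "lcoeff (1 :: 'k lseries) 0 = 1"
    by (simp add: lcoeff_1 zero_fun_def)
  with Suc show ?case
    by (simp only: of_nat_Suc lcoeff_add)
qed (simp add: lcoeff_0)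

lemma shifted_cone_0_mono: "M \<le> M' \<Longrightarrow> shifted_cone n d M 0 \<subseteq> shifted_cone n d M' 0"
  using prefix_sum_pow_nonneg [of M M'] by (auto simp: shifted_cone_def)

section \<open>Roots of monic polynomials\<close>

lemma coeff_shift_top:
  fixes p :: "'a::comm_ring_1 poly"
  assumes "\<And>i. N < i \<Longrightarrow> Polynomial.coeff p i = 0"
  shows "Polynomial.coeff (pcompose p [:s, 1:]) N = Polynomial.coeff p N"
  using assms
proof (induction p arbitrary: N)
  case (pCons a p)
  have top: "Polynomial.coeff p i = 0" if "N \<le> i" for i
    using pCons.prems [of "Suc i"] that by simp
  have "Polynomial.coeff (pcompose p [:s, 1:]) N = Polynomial.coeff p N"
    using top by (intro pCons.IH) simp
  hence 0: "Polynomial.coeff (pcompose p [:s, 1:]) N = 0"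
    using top by simp
  show ?case
  proof (cases N)
    case 0
    thus ?thesis
      using \<open>Polynomial.coeff (pcompose p [:s, 1:]) N = 0\<close> by (simp add: pcompose_pCons)
  next
    case (Suc k)
    have "Polynomial.coeff (pcompose p [:s, 1:]) k = Polynomial.coeff p k"
      using top Suc by (intro pCons.IH) simp
    thus ?thesis
      using 0 Suc by (simp add: pcompose_pCons)
  qed
qed simp

text \<open>
  For a monic polynomial of degree \<open>N + 1\<close>, the choice of \<open>s\<close> as minus the second coefficient
  divided by \<open>N + 1\<close> makes the second coefficient vanish.
\<close>

lemma coeff_shift_second:
  fixes p :: "'a::comm_ring_1 poly"
  assumes "\<And>i. Suc N < i \<Longrightarrow> Polynomial.coeff p i = 0"
  shows "Polynomial.coeff (pcompose p [:s, 1:]) N =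
    Polynomial.coeff p N + of_nat (Suc N) * s * Polynomial.coeff p (Suc N)"
  using assms
proof (induction p arbitrary: N)
  case (pCons a p)
  have top: "Polynomial.coeff p i = 0" if "N < i" for i
    using pCons.prems [of "Suc i"] that by simp
  have t: "Polynomial.coeff (pcompose p [:s, 1:]) N = Polynomial.coeff p N"
    using top by (rule coeff_shift_top)
  show ?case
  proof (cases N)
    case 0
    thus ?thesis
      using t by (simp add: pcompose_pCons)
  next
    case (Suc k)
    have "Polynomial.coeff (pcompose p [:s, 1:]) k =
        Polynomial.coeff p k + of_nat (Suc k) * s * Polynomial.coeff p (Suc k)"
      using top Suc by (intro pCons.IH) simp
    thus ?thesis
      using t Suc by (simp add: pcompose_pCons algebra_simps)
  qed
qed simp

text \<open>
  If a root \<open>r\<close> had multiplicity \<open>m\<close>, then \<open>P = (T - r)\<^sup>m\<close>, and the vanishing of the second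
  coefficient \<open>- m r\<close> would give \<open>r = 0\<close> in characteristic zero; but \<open>P\<close> is not \<open>T\<^sup>m\<close>.  So the
  power of \<open>T - r\<close> that divides \<open>P\<close> exactly is a factor of lower degree, coprime to its cofactor.
\<close>

lemma monic_split_off_root:
  fixes P :: "'k::{alg_closed_field, field_char_0} poly"
  assumes m: "Polynomial.degree P = m" "Polynomial.coeff P m = 1"
    and second: "Polynomial.coeff P (m - 1) = 0"
    and i: "i < m" "Polynomial.coeff P i \<noteq> 0"
  shows "\<exists>g h u v. P = g * h \<and> u * g + v * h = 1 \<and> 0 < Polynomial.degree g \<and>
    Polynomial.coeff g (Polynomial.degree g) = 1 \<and> 0 < Polynomial.degree h"
proof -
  obtain r where r: "poly P r = 0"
    using alg_closed_imp_poly_has_root [of P] m i(1) by auto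
  have P: "P \<noteq> 0"
    using m by auto
  define e where "e = Polynomial.order r P"
  obtain h where h: "P = [:- r, 1:] ^ e * h" "\<not> [:- r, 1:] dvd h"
    using order_decomp [OF P, of r] unfolding e_def by blast
  have hr: "poly h r \<noteq> 0"
    using h(2) by (simp add: poly_eq_0_iff_dvd)
  then obtain u v where uv: "u * [:- r, 1:] ^ e + v * h = 1"
    using linear_power_coprime by blast
  have e: "0 < e"
    using r P by (simp add: e_def order_root)
  have g: "Polynomial.degree ([:- r, 1:] ^ e) = e"
    by (rule degree_linear_power)
  have gl: "Polynomial.coeff ([:- r, 1:] ^ e) e = 1"
    by (simp add: coeff_linear_poly_power)
  have "Polynomial.degree h \<noteq> 0"
  proof
    assume "Polynomial.degree h = 0"
    then obtain c where c: "h = [:c:]"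
      by (elim degree_eq_zeroE)
    hence "c \<noteq> 0" using hr by auto
    hence "e = m"
      using m(1) g by (simp add: h(1) c)
    have Pc: "Polynomial.coeff P j = c * of_nat (m choose j) * (- r) ^ (m - j)" if "j \<le> m" for j
      using that by (simp add: h(1) c \<open>e = m\<close> coeff_linear_poly_power)
    have "r = 0"
      using Pc [of "m - 1"] second i(1) \<open>c \<noteq> 0\<close> by auto
    thus False
      using Pc [of i] i by simp
  qed
  thus ?thesis
    using h(1) uv e g gl by (intro exI [of _ "[:- r, 1:] ^ e"] exI [of _ h] exI [of _ u] exI [of _ v]) simp
qed

lemma poly_eq_sum_le:
  "Polynomial.degree p \<le> m \<Longrightarrow> poly p x = (\<Sum>i\<le>m. Polynomial.coeff p i * x ^ i)"
  for p :: "'a::comm_ring_1 poly"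
  unfolding poly_altdef by (rule sum.mono_neutral_left) (auto simp: coeff_eq_0)

text \<open>
  The Newton polygon step.  For the nonzero coefficients with \<open>i < m\<close>, let \<open>v\<^sub>i\<close> be the
  value of the coefficient of \<open>T\<^sup>i\<close> and \<open>\<gamma>\<close> the
  least of the slopes \<open>v\<^sub>i / (m - i)\<close>, attained at \<open>k\<close>.  With \<open>t = x\<^sup>\<gamma>\<close>, the polynomial
  \<open>Q(T) = t\<^sup>-\<^sup>m q(t T)\<close> has coefficients of nonnegative value, and its \<open>k\<close>-th coefficient has
  value \<open>0\<close>.  The layer of \<open>Q\<close> at \<open>0\<close> splits into coprime factors, and so does \<open>Q\<close>.
\<close>

lemma monic_depressed_factor:
  fixes q :: "'k::{alg_closed_field, field_char_0} lseries poly"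
  assumes q: "\<And>i. Polynomial.coeff q i \<in> cone_laurent_field n"
    and m: "Polynomial.degree q = m" "Polynomial.coeff q m = 1"
    and second: "Polynomial.coeff q (m - 1) = 0"
    and nz: "i < m" "Polynomial.coeff q i \<noteq> 0"
  shows "\<exists>t t' G H. t \<in> cone_laurent_field n \<and> t * t' = 1 \<and>
    0 < Polynomial.degree G \<and> Polynomial.degree G < m \<and> Polynomial.coeff G (Polynomial.degree G) = 1 \<and>
    (\<forall>i. Polynomial.coeff G i \<in> cone_laurent_field n) \<and>
    (\<forall>y. poly q (t * y) = t ^ m * (poly G y * poly H y))"
proof -
  define I where "I = {i. i < m \<and> Polynomial.coeff q i \<noteq> 0}"
  have I: "finite I" "I \<noteq> {}"
    using nz by (auto simp: I_def)
  obtain d where d: "0 < d" "\<And>i. i \<le> m \<Longrightarrow> Polynomial.coeff q i \<in> cone_laurent n d"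
    using cone_laurent_field_common [of "{..m}" "Polynomial.coeff q" n] q by auto
  have "\<exists>v. v \<in> lsupp (Polynomial.coeff q i) \<and> (\<forall>a\<in>lsupp (Polynomial.coeff q i). lex_nonneg (a - v))"
    if "i \<in> I" for i
  proof -
    have "lsupp (Polynomial.coeff q i) \<noteq> {}"
      using that lseries_eqI [of "Polynomial.coeff q i" 0] by (auto simp: I_def lsupp_def lcoeff_0)
    moreover have "lsupp (Polynomial.coeff q i) \<in> laurent_supports n d"
      using d(2) [of i] that by (intro cone_laurent_lsupp) (simp add: I_def)
    ultimately show ?thesis
      using laurent_supports_lex_minimum [OF d(1)] by blast
  qed
  then obtain v where v: "\<And>i. i \<in> I \<Longrightarrow> v i \<in> lsupp (Polynomial.coeff q i)"
    "\<And>i a. i \<in> I \<Longrightarrow> a \<in> lsupp (Polynomial.coeff q i) \<Longrightarrow> lex_nonneg (a - v i)"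
    by metis
  define slope where "slope i = (\<lambda>j. v i j / of_nat (m - i))" for i
  obtain k where k: "k \<in> I" "\<And>i. i \<in> I \<Longrightarrow> lex_nonneg (slope i - slope k)"
    using lex_minimum_finite [OF I, of slope] by blast
  \<comment> \<open>the denominator that the slope \<open>v k / (m - k)\<close> requires\<close>
  define D where "D = d * (m - k)"
  have km: "k < m" and D: "0 < D"
    using k(1) d(1) by (auto simp: I_def D_def)
  have qD: "Polynomial.coeff q i \<in> cone_laurent n D" if "i \<le> m" for i
    unfolding D_def using d(2) [OF that] by (rule cone_laurent_refine)
  have "v k \<in> exponents n d"
    using cone_laurent_exponents [OF d(2) v(1) [OF k(1)]] km by simp
  hence slope: "slope k \<in> exponents n D"
    using km by (auto simp: exponents_def slope_def D_def)
  define t :: "'k lseries" where "t = lmonom (slope k) 1"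
  define t' :: "'k lseries" where "t' = lmonom (- slope k) 1"
  have tt: "t * t' = 1"
    using lmonom_inverse [OF D slope, of 1] by (simp add: t_def t'_def)
  have tD: "t \<in> cone_laurent n D" and t'D: "t' \<in> cone_laurent n D"
    unfolding t_def t'_def using D slope exponents_uminus [OF slope] by (simp_all add: cone_laurent_lmonom)
  define w where "w i = (\<lambda>j. of_nat (m - i) * (- slope k) j)" for i
  have wexp: "w i \<in> exponents n D" for i
    unfolding w_def by (rule conjunct2 [OF lmonom_power [OF D exponents_uminus [OF slope]]])
  have t'pow: "t' ^ (m - i) = lmonom (w i) 1" for i
    unfolding w_def t'_def by (rule conjunct1 [OF lmonom_power [OF D exponents_uminus [OF slope]]])
  obtain Q where Q: "\<And>i. Polynomial.coeff Q i = (if i \<le> m then t' ^ (m - i) * Polynomial.coeff q i else 0)"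
    using ex_poly_coeffs [of m "\<lambda>i. t' ^ (m - i) * Polynomial.coeff q i"] by blast
  have Qdeg: "Polynomial.degree Q \<le> m"
    by (rule degree_le) (simp add: Q)
  have Qm: "Polynomial.coeff Q m = 1"
    by (simp add: Q m)
  have lQ: "lcoeff (Polynomial.coeff Q i) a = lcoeff (Polynomial.coeff q i) (a - w i)" if "i \<le> m" for i a
    using that by (simp only: Q t'pow lcoeff_lmonom_mult [OF D wexp] mult_1 if_True)
  have QD: "Polynomial.coeff Q i \<in> cone_laurent n D" for i
  proof (cases "i \<le> m")
    case True
    thus ?thesis
      unfolding Q t'pow using cone_laurent_mult [OF cone_laurent_lmonom [OF D wexp] qD [OF True]]
      by (simp only: if_True)
  qed (simp add: Q cone_laurent_0)
  have Qlex: "lex_nonneg a" if a: "a \<in> lsupp (Polynomial.coeff Q i)" for i a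
  proof -
    consider "i = m" | "i \<in> I" | "i < m" "Polynomial.coeff q i = 0" | "m < i"
      using linorder_less_linear [of i m] unfolding I_def by blast
    thus ?thesis
    proof cases
      case 1
      thus ?thesis
        using a by (simp add: Qm lsupp_simps lex_nonneg_zero)
    next
      case 2
      hence i: "i < m" by (simp add: I_def)
      have "a - w i \<in> lsupp (Polynomial.coeff q i)"
        using a i lQ [of i a] by (simp only: lsupp_iff less_imp_le not_False_eq_True)
      hence 1: "lex_nonneg (a - w i - v i)"
        using v(2) 2 by blast
      have "(\<lambda>j. of_nat (m - i) * (slope i - slope k) j) = v i + w i"
        using i by (auto simp: w_def slope_def fun_eq_iff right_diff_distrib)
      hence "lex_nonneg (v i + w i)"
        using lex_nonneg_scale [OF k(2) [OF 2], of "of_nat (m - i)"] by simp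
      with 1 have "lex_nonneg (a - w i - v i + (v i + w i))"
        by (rule lex_nonneg_add)
      moreover have "a - w i - v i + (v i + w i) = a"
        by (auto simp: fun_eq_iff)
      ultimately show ?thesis by (simp only:)
    next
      case 3
      thus ?thesis
        using a by (simp add: Q lsupp_simps)
    next
      case 4
      thus ?thesis
        using a by (simp add: Q lsupp_simps)
    qed
  qed
  have "\<exists>M. lsupp (Polynomial.coeff Q i) \<subseteq> shifted_cone n D M 0" for i
    using lex_nonneg_in_cone [OF D QD] Qlex by blast
  then obtain Ms where Ms: "\<And>i. lsupp (Polynomial.coeff Q i) \<subseteq> shifted_cone n D (Ms i) 0"
    by metis
  define M where "M = Max (Ms ` {..m})"
  have QM: "lsupp (Polynomial.coeff Q i) \<subseteq> shifted_cone n D M 0" for i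
  proof (cases "i \<le> m")
    case True
    hence "Ms i \<le> M"
      unfolding M_def by (intro Max_ge) auto
    thus ?thesis
      using Ms shifted_cone_0_mono by blast
  qed (simp add: Q lsupp_simps)
  define P where "P = layer Q 0"
  have Pm: "Polynomial.coeff P m = 1"
    by (simp add: P_def coeff_layer Qm lcoeff_1 zero_fun_def)
  have Pdeg: "Polynomial.degree P = m"
  proof (rule antisym)
    show "Polynomial.degree P \<le> m"
      by (rule degree_le) (simp add: P_def coeff_layer Q lcoeff_0)
    show "m \<le> Polynomial.degree P"
      using Pm by (intro le_degree) simp
  qed
  have P2: "Polynomial.coeff P (m - 1) = 0"
    using second by (simp add: P_def coeff_layer Q lcoeff_0)
  have "0 - w k = v k"
    using km by (auto simp: w_def slope_def fun_eq_iff)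
  hence "lcoeff (Polynomial.coeff Q k) 0 \<noteq> 0"
    using lQ [of k 0] v(1) [OF k(1)] km by (simp only: lsupp_iff less_imp_le not_False_eq_True)
  hence Pk: "Polynomial.coeff P k \<noteq> 0"
    by (simp only: P_def coeff_layer not_False_eq_True)
  obtain g h u v where gh: "P = g * h" "u * g + v * h = 1"
    and g: "0 < Polynomial.degree g" "Polynomial.coeff g (Polynomial.degree g) = 1"
    and h: "0 < Polynomial.degree h"
    using monic_split_off_root [OF Pdeg Pm P2 km Pk] by blast
  have degs: "m = Polynomial.degree g + Polynomial.degree h"
    using g h unfolding Pdeg [symmetric] gh(1) by (intro degree_mult_eq) auto
  obtain G H where GH: "Q = G * H" "Polynomial.degree G = Polynomial.degree g"
    "Polynomial.coeff G (Polynomial.degree G) = 1" "\<And>i. lsupp (Polynomial.coeff G i) \<subseteq> shifted_cone n D M 0"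
    using hensel_factorization [OF D QM _ _ gh(1) [unfolded P_def] gh(2) g h] Qdeg Qm unfolding degs by blast
  have "poly q (t * y) = t ^ m * (poly G y * poly H y)" for y
  proof -
    have "poly q (t * y) = (\<Sum>i\<le>m. Polynomial.coeff q i * (t * y) ^ i)"
      using m(1) by (intro poly_eq_sum_le) simp
    also have "\<dots> = (\<Sum>i\<le>m. t ^ m * (Polynomial.coeff Q i * y ^ i))"
    proof (rule sum.cong)
      fix i assume "i \<in> {..m}"
      hence i: "i \<le> m" by simp
      have "t ^ m * t' ^ (m - i) = t ^ i * (t * t') ^ (m - i)"
        using i by (simp add: power_mult_distrib mult.assoc [symmetric] power_add [symmetric])
      hence "t ^ i = t ^ m * t' ^ (m - i)"
        by (simp add: tt)
      thus "Polynomial.coeff q i * (t * y) ^ i = t ^ m * (Polynomial.coeff Q i * y ^ i)"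
        unfolding power_mult_distrib using i by (simp add: Q mult_ac)
    qed simp
    also have "\<dots> = t ^ m * poly Q y"
      using poly_eq_sum_le [OF Qdeg, of y] by (simp add: sum_distrib_left)
    finally show ?thesis
      by (simp add: GH(1))
  qed
  moreover have "Polynomial.coeff G i \<in> cone_laurent_field n" for i
    using cone_laurent_fieldI [OF D cone_laurentI [OF GH(4)]] .
  moreover have "t \<in> cone_laurent_field n"
    using D tD by (rule cone_laurent_fieldI)
  ultimately show ?thesis
    using tt GH(2,3) g(1) h degs
    by (intro exI [of _ t] exI [of _ t'] exI [of _ G] exI [of _ H] conjI allI) simp_all
qed

text \<open>
  By induction on the degree: after the shift that removes the second coefficient, either only the
  leading term is left and \<open>0\<close> is a root, or the Newton polygon step provides a factor of smaller
  positive degree.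
\<close>

lemma monic_has_root:
  fixes p :: "'k::{alg_closed_field, field_char_0} lseries poly"
  assumes "\<And>i. Polynomial.coeff p i \<in> cone_laurent_field n"
    and "0 < Polynomial.degree p" "Polynomial.coeff p (Polynomial.degree p) = 1"
  shows "\<exists>x\<in>cone_laurent_field n. poly p x = 0"
  using assms
proof (induction "Polynomial.degree p" arbitrary: p rule: less_induct)
  case less
  define m where "m = Polynomial.degree p"
  have m: "0 < m"
    using less.prems by (simp add: m_def)
  have "(of_nat m :: 'k lseries) \<noteq> 0"
  proof
    assume "(of_nat m :: 'k lseries) = 0"
    hence "lcoeff (of_nat m :: 'k lseries) 0 = 0"
      by (simp only: lcoeff_0)
    thus False
      using m unfolding lcoeff_of_nat_0 by simp
  qed
  then obtain j :: "'k lseries" where j: "j \<in> cone_laurent_field n" "of_nat m * j = 1"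
    using cone_laurent_field_inverse [OF of_nat_cone_laurent_field] by blast
  define s where "s = - (Polynomial.coeff p (m - 1) * j)"
  have s: "s \<in> cone_laurent_field n"
    unfolding s_def using less.prems(1) j(1)
    by (intro cone_laurent_field_uminus cone_laurent_field_mult)
  define q where "q = pcompose p [:s, 1:]"
  have qK: "Polynomial.coeff q i \<in> cone_laurent_field n" for i
    unfolding q_def
    by (rule coeff_pcompose_semiring_closed)
      (auto simp: cone_laurent_field_0 cone_laurent_field_1 cone_laurent_field_add cone_laurent_field_mult
        s less.prems(1) coeff_pCons split: nat.split)
  have qm: "Polynomial.coeff q m = 1"
    unfolding q_def using less.prems(3)
    by (subst coeff_shift_top) (simp_all add: m_def coeff_eq_0)
  have "Polynomial.degree q \<le> m"
    unfolding q_def m_def using degree_pcompose_le [of p "[:s, 1:]"] by simp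
  hence qdeg: "Polynomial.degree q = m"
    using le_degree [of q m] qm by simp
  have "Polynomial.coeff q (m - 1) = Polynomial.coeff p (m - 1) + of_nat m * s * Polynomial.coeff p m"
    using coeff_shift_second [of "m - 1" p s] m by (simp add: q_def m_def coeff_eq_0)
  also have "\<dots> = Polynomial.coeff p (m - 1) - Polynomial.coeff p (m - 1) * (of_nat m * j)"
    using less.prems(3) by (simp add: s_def m_def mult_ac)
  also have "\<dots> = 0"
    by (simp add: j(2))
  finally have q2: "Polynomial.coeff q (m - 1) = 0" .
  have "\<exists>x\<in>cone_laurent_field n. poly q x = 0"
  proof (cases "\<exists>i<m. Polynomial.coeff q i \<noteq> 0")
    case True
    then obtain t t' G H where tG: "t \<in> cone_laurent_field n" "t * t' = 1"
      "0 < Polynomial.degree G" "Polynomial.degree G < m" "Polynomial.coeff G (Polynomial.degree G) = 1"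
      "\<And>i. Polynomial.coeff G i \<in> cone_laurent_field n"
      "\<And>y. poly q (t * y) = t ^ m * (poly G y * poly H y)"
      using monic_depressed_factor [OF qK qdeg qm q2] by blast
    obtain y where "y \<in> cone_laurent_field n" "poly G y = 0"
      using less.hyps [of G] tG(3-6) by (auto simp: m_def)
    hence "t * y \<in> cone_laurent_field n" "poly q (t * y) = 0"
      using tG(1,7) by (simp_all add: cone_laurent_field_mult)
    thus ?thesis by blast
  next
    case False
    hence "poly q 0 = 0"
      using m by (simp add: poly_0_coeff_0)
    thus ?thesis
      using cone_laurent_field_0 by blast
  qed
  then obtain x where "x \<in> cone_laurent_field n" "poly p (s + x) = 0"
    by (auto simp: q_def poly_pcompose)
  thus ?case
    using s cone_laurent_field_add by blast
qed

section \<open>Cofinality of the prefix sum cones in $\Lambda$\<close>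

lemma prefix_sum_pow_local:
  "(\<forall>i<n. a i = b i) \<Longrightarrow> (\<forall>i<n. (prefix_sum ^^ N) a i = (prefix_sum ^^ N) b i)"
proof (induction N)
  case (Suc N)
  have "prefix_sum ((prefix_sum ^^ N) a) i = prefix_sum ((prefix_sum ^^ N) b) i" if "i < n" for i
    unfolding prefix_sum_def [of "(prefix_sum ^^ N) a" i] prefix_sum_def [of "(prefix_sum ^^ N) b" i]
    using Suc that by (intro sum.cong) auto
  thus ?case by simp
qed simp

lemma prefix_sum_pow_of_rat:
  "(prefix_sum ^^ N) (\<lambda>i. of_rat (a i)) i = (of_rat ((prefix_sum ^^ N) a i) :: 'a::field_char_0)"
proof (induction N arbitrary: i)
  case (Suc N)
  have "(prefix_sum ^^ N) (\<lambda>i. of_rat (a i)) = (\<lambda>i. of_rat ((prefix_sum ^^ N) a i) :: 'a)"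
    using Suc by blast
  thus ?case
    by (simp add: prefix_sum_def [of "\<lambda>i. of_rat ((prefix_sum ^^ N) a i) :: 'a"] prefix_sum_def [of "(prefix_sum ^^ N) a"] of_rat_sum)
qed simp

lemma prefix_sum_pow_ge:
  fixes a :: "nat \<Rightarrow> 'a::ordered_comm_monoid_add"
  assumes "\<And>i. 0 \<le> a i"
  shows "a i \<le> (prefix_sum ^^ N) a i"
proof (induction N)
  case (Suc N)
  have "0 \<le> (prefix_sum ^^ N) a l" for l
    using prefix_sum_pow_nonneg [of 0 N "Suc l" a l] assms by simp
  hence "0 \<le> (\<Sum>l<i. (prefix_sum ^^ N) a l)"
    by (simp add: sum_nonneg)
  with Suc have "a i + 0 \<le> (prefix_sum ^^ N) a i + (\<Sum>l<i. (prefix_sum ^^ N) a l)"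
    by (rule add_mono)
  thus ?case
    by (simp add: prefix_sum_eq [of "(prefix_sum ^^ N) a"])
qed simp

text \<open>
  A blow-down changes an entry by an earlier one, so compositions are lower unitriangular matrices.
\<close>

lemma blow_downs_bound:
  assumes "\<Phi> \<in> blow_downs n"
  shows "\<exists>C\<ge>0. \<forall>a\<in>orthant n. \<forall>i<n. \<bar>\<Phi> a i - a i\<bar> \<le> C * (\<Sum>l<i. a l)"
  using assms
proof induction
  case empty
  show ?case
    by (intro exI [of _ 0]) simp
next
  case (comp \<Phi> p q)
  then obtain C where C: "0 \<le> C" "\<And>a i. a \<in> orthant n \<Longrightarrow> i < n \<Longrightarrow> \<bar>\<Phi> a i - a i\<bar> \<le> C * (\<Sum>l<i. a l)"
    by blast
  have "\<bar>(blow_down p q \<circ> \<Phi>) a i - a i\<bar> \<le> (2 * C + 1) * (\<Sum>l<i. a l)" if a: "a \<in> orthant n" and i: "i < n" for a i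
  proof -
    define S where "S = (\<Sum>l<i. a l)"
    have nn: "0 \<le> a l" if "l < n" for l
      using a that by (simp add: orthant_def)
    have S: "0 \<le> S"
      unfolding S_def using nn i by (intro sum_nonneg) auto
    have CS: "0 \<le> C * S"
      using C(1) S by simp
    have 1: "\<bar>\<Phi> a i - a i\<bar> \<le> C * S"
      unfolding S_def using C(2) [OF a i] .
    show ?thesis
    proof (cases "i = q")
      case False
      thus ?thesis
        using 1 S CS by (simp add: blow_down_def S_def [symmetric] algebra_simps)
    next
      case True
      have "\<bar>\<Phi> a p - a p\<bar> \<le> C * (\<Sum>l<p. a l)"
        using C(2) [OF a, of p] comp.hyps by simp
      moreover have "C * (\<Sum>l<p. a l) \<le> C * S"
        unfolding S_def True using nn comp.hyps C(1)
        by (intro mult_left_mono sum_mono2) auto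
      moreover have "a p \<le> S"
        unfolding S_def True using nn comp.hyps by (intro member_le_sum) auto
      moreover have "0 \<le> a p"
        using nn comp.hyps by simp
      moreover have "(blow_down p q \<circ> \<Phi>) a i - a i = (\<Phi> a i - a i) - (\<Phi> a p - a p) - a p"
        using True by (simp add: blow_down_def)
      moreover have "(2 * C + 1) * S = C * S + C * S + S"
        by (simp add: algebra_simps)
      ultimately show ?thesis
        using 1 unfolding S_def [symmetric] by linarith
    qed
  qed
  thus ?case
    using C(1) by (intro exI [of _ "2 * C + 1"]) auto
qed

lemma cone_prefix_sum_nonneg:
  assumes "\<Gamma> \<in> cones n"
  shows "\<exists>N. \<forall>b\<in>\<Gamma>. \<forall>i<n. 0 \<le> (prefix_sum ^^ N) b i"
proof -
  obtain \<Phi> where \<Phi>: "\<Gamma> = \<Phi> ` orthant n" "\<Phi> \<in> blow_downs n"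
    using assms by (auto simp: cones_def)
  obtain C where C: "0 \<le> C" "\<And>a i. a \<in> orthant n \<Longrightarrow> i < n \<Longrightarrow> \<bar>\<Phi> a i - a i\<bar> \<le> C * (\<Sum>l<i. a l)"
    using blow_downs_bound [OF \<Phi>(2)] by blast
  obtain N where N: "\<And>a b i. dominates n C a b \<Longrightarrow> i < n \<Longrightarrow> 0 \<le> (prefix_sum ^^ N) b i"
    using prefix_sum_pow_eventually_nonneg [OF C(1)] by blast
  have "dominates n C a (\<Phi> a)" if "a \<in> orthant n" for a
    unfolding dominates_def
  proof (intro allI impI conjI)
    fix i assume "i < n"
    thus "0 \<le> a i" "a i - C * (\<Sum>l<i. a l) \<le> \<Phi> a i"
      using C(2) [OF that, of i] that by (auto simp: orthant_def abs_le_iff)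
  qed
  thus ?thesis
    unfolding \<Phi>(1) using N by blast
qed

definition prefix_sum_cone :: "nat \<Rightarrow> nat \<Rightarrow> (nat \<Rightarrow> real) set" where
  "prefix_sum_cone n N = {b. (\<forall>i<n. 0 \<le> (prefix_sum ^^ N) b i) \<and> (\<forall>i\<ge>n. b i = 0)}"

lemma blow_down_cone:
  assumes "\<Gamma> \<in> cones n" "i < j" "j < n"
  shows "blow_down i j ` \<Gamma> \<in> cones n"
proof -
  obtain \<Phi> where \<Phi>: "\<Gamma> = \<Phi> ` orthant n" "\<Phi> \<in> blow_downs n"
    using assms by (auto simp: cones_def)
  have "blow_down i j ` \<Gamma> = (blow_down i j \<circ> \<Phi>) ` orthant n"
    by (simp add: \<Phi>(1) image_comp)
  thus ?thesis
    unfolding cones_def using blow_downs.comp [OF \<Phi>(2) assms(2,3)] by blast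
qed

text \<open>
  For \<open>k = 1\<close> this is the inverse of taking prefix sums on the first \<open>n\<close> coordinates.  The
  parameter \<open>k\<close> allows it to be built up from single blow-downs, which have to be applied from the
  last coordinate to the first since each subtracts an entry that must still be unchanged.
\<close>

definition adjacent_diffs :: "nat \<Rightarrow> nat \<Rightarrow> (nat \<Rightarrow> real) \<Rightarrow> nat \<Rightarrow> real" where
  "adjacent_diffs n k a i = (if k \<le> i \<and> i < n then a i - a (i - 1) else a i)"

lemma adjacent_diffs_cone:
  assumes "\<Gamma> \<in> cones n" "k \<le> n" "1 \<le> k"
  shows "adjacent_diffs n k ` \<Gamma> \<in> cones n"
  using assms(2,3)
proof (induction k rule: inc_induct)
  case base
  have "adjacent_diffs n n = id"
    by (simp add: fun_eq_iff adjacent_diffs_def)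
  thus ?case using assms(1) by simp
next
  case (step k)
  have "adjacent_diffs n k a = blow_down (k - 1) k (adjacent_diffs n (Suc k) a)" for a
    using step by (auto simp: fun_eq_iff adjacent_diffs_def blow_down_def)
  hence "adjacent_diffs n k ` \<Gamma> = blow_down (k - 1) k ` adjacent_diffs n (Suc k) ` \<Gamma>"
    by (simp add: image_comp o_def)
  thus ?case
    using step by (simp add: blow_down_cone)
qed

lemma prefix_sum_adjacent_diffs:
  assumes "i < n"
  shows "prefix_sum (adjacent_diffs n 1 a) i = a i"
  using assms
proof (induction i)
  case 0
  thus ?case by (simp add: prefix_sum_def adjacent_diffs_def)
next
  case (Suc i)
  have "prefix_sum (adjacent_diffs n 1 a) (Suc i) = prefix_sum (adjacent_diffs n 1 a) i + adjacent_diffs n 1 a (Suc i)"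
    by (simp add: prefix_sum_def)
  moreover have "adjacent_diffs n 1 a (Suc i) = a (Suc i) - a i"
    using Suc by (simp add: adjacent_diffs_def)
  ultimately show ?case
    using Suc by simp
qed

lemma prefix_sum_cone_in_cones:
  assumes "1 \<le> n"
  shows "prefix_sum_cone n N \<in> cones n"
proof (induction N)
  case 0
  have "prefix_sum_cone n 0 = id ` orthant n"
    by (auto simp: prefix_sum_cone_def orthant_def)
  thus ?case
    unfolding cones_def using blow_downs.empty by blast
next
  case (Suc N)
  have "prefix_sum_cone n (Suc N) = adjacent_diffs n 1 ` prefix_sum_cone n N"
  proof (intro subset_antisym subsetI)
    fix b assume b: "b \<in> prefix_sum_cone n (Suc N)"
    define a where "a i = (if i < n then prefix_sum b i else 0)" for i
    have "\<forall>i<n. (prefix_sum ^^ N) a i = (prefix_sum ^^ N) (prefix_sum b) i"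
      by (rule prefix_sum_pow_local) (simp add: a_def)
    hence "a \<in> prefix_sum_cone n N"
      using b by (simp add: prefix_sum_cone_def a_def funpow_swap1)
    moreover have "adjacent_diffs n 1 a = b"
    proof
      fix i
      show "adjacent_diffs n 1 a i = b i"
        using b by (cases i) (auto simp: adjacent_diffs_def a_def prefix_sum_cone_def prefix_sum_def)
    qed
    ultimately show "b \<in> adjacent_diffs n 1 ` prefix_sum_cone n N"
      by blast
  next
    fix b assume "b \<in> adjacent_diffs n 1 ` prefix_sum_cone n N"
    then obtain a where a: "a \<in> prefix_sum_cone n N" "b = adjacent_diffs n 1 a"
      by blast
    have "\<forall>i<n. (prefix_sum ^^ N) (prefix_sum b) i = (prefix_sum ^^ N) a i"
      by (rule prefix_sum_pow_local) (simp add: a(2) prefix_sum_adjacent_diffs [unfolded One_nat_def])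
    moreover have "b i = 0" if "n \<le> i" for i
      using a that by (simp add: prefix_sum_cone_def adjacent_diffs_def)
    ultimately show "b \<in> prefix_sum_cone n (Suc N)"
      using a(1) by (simp add: prefix_sum_cone_def funpow_swap1)
  qed
  thus ?case
    using adjacent_diffs_cone [OF Suc assms] by simp
qed

section \<open>Identification with the quotient fields\<close>

lemma laurent_supports_exponents: "A \<in> laurent_supports n d \<Longrightarrow> a \<in> A \<Longrightarrow> a \<in> exponents n d"
proof (induction n arbitrary: A a)
  case 0
  thus ?case by (auto simp: exponents_def)
next
  case (Suc n)
  let ?b = "\<lambda>i. a (Suc i)"
  have A: "case_nat (a 0) ?b \<in> A"
    using Suc.prems(2) case_nat_split [of a] by simp
  have "{b. case_nat (a 0) b \<in> A} \<in> laurent_supports n d"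
    using Suc.prems(1) by simp
  hence b: "?b \<in> exponents n d"
    by (rule Suc.IH) (use A in blast)
  moreover have "of_nat d * a 0 \<in> \<int>"
    using Suc.prems(1) A unfolding laurent_supports.simps by blast
  ultimately have "of_nat d * a i \<in> \<int>" for i
    by (cases i) (auto simp: exponents_def)
  moreover have "a i = 0" if "Suc n \<le> i" for i
    using b that by (cases i) (auto simp: exponents_def)
  ultimately show ?case
    by (simp add: exponents_def)
qed

lemma iterated_laurent_lcoeff:
  assumes "0 < d" "f \<in> iterated_laurent n d"
  shows "lcoeff (Abs_lseries f) = f"
  using assms by (intro Abs_lseries_inverse) blast

lemma cone_series_cone_laurent:
  assumes d: "0 < d" and \<Gamma>: "\<Gamma> \<in> cones n" and f: "f \<in> cone_series n \<Gamma> d"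
  shows "\<exists>x\<in>cone_laurent n d. lcoeff x = f"
proof
  have il: "f \<in> iterated_laurent n d" and nd: "newton_diagram f \<subseteq> \<Gamma>"
    using f by (auto simp: cone_series_def)
  show l: "lcoeff (Abs_lseries f) = f"
    using d il by (rule iterated_laurent_lcoeff)
  obtain N where N: "\<And>b i. b \<in> \<Gamma> \<Longrightarrow> i < n \<Longrightarrow> 0 \<le> (prefix_sum ^^ N) b i"
    using cone_prefix_sum_nonneg [OF \<Gamma>] by blast
  have "a \<in> shifted_cone n d N 0" if a: "f a \<noteq> 0" for a
  proof -
    have "a \<in> exponents n d"
      using laurent_supports_exponents [of "{a. f a \<noteq> 0}"] il a by (simp add: iterated_laurent_iff)
    moreover have "(\<lambda>i. of_rat (a i)) \<in> \<Gamma>"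
      using nd a by (auto simp: newton_diagram_def)
    hence "0 \<le> (prefix_sum ^^ N) a i" if "i < n" for i
      using N that by (fastforce simp: prefix_sum_pow_of_rat)
    ultimately show ?thesis
      by (simp add: shifted_cone_def)
  qed
  thus "Abs_lseries f \<in> cone_laurent n d"
    by (intro cone_laurentI [of _ _ _ N 0]) (auto simp: lsupp_def l)
qed

lemma cone_laurent_iterated: "x \<in> cone_laurent n d \<Longrightarrow> lcoeff x \<in> iterated_laurent n d"
  using cone_laurent_lsupp [of x n d] by (simp add: iterated_laurent_iff lsupp_def)

text \<open>
  The inverse in the field of iterated Laurent series is given by a description.  It is unique because
  all candidates belong to the commutative ring of all iterated Laurent series.
\<close>

lemma laurent_field_inv:
  assumes d: "0 < d" and y: "y \<in> cone_laurent n d" and xy: "x * y = 1"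
  shows "inv\<^bsub>laurent_field n d\<^esub> (lcoeff x) = lcoeff y"
  unfolding m_inv_def
proof (rule the_equality)
  show "lcoeff y \<in> carrier (laurent_field n d) \<and>
      lcoeff x \<otimes>\<^bsub>laurent_field n d\<^esub> lcoeff y = \<one>\<^bsub>laurent_field n d\<^esub> \<and>
      lcoeff y \<otimes>\<^bsub>laurent_field n d\<^esub> lcoeff x = \<one>\<^bsub>laurent_field n d\<^esub>"
    using cone_laurent_iterated [OF y] xy
    by (simp add: series_ring_def lcoeff_mult [symmetric] lcoeff_1 [symmetric] mult.commute)
next
  fix f
  assume f: "f \<in> carrier (laurent_field n d) \<and>
      lcoeff x \<otimes>\<^bsub>laurent_field n d\<^esub> f = \<one>\<^bsub>laurent_field n d\<^esub> \<and>
      f \<otimes>\<^bsub>laurent_field n d\<^esub> lcoeff x = \<one>\<^bsub>laurent_field n d\<^esub>"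
  define z where "z = Abs_lseries f"
  have z: "f = lcoeff z"
    unfolding z_def using f iterated_laurent_lcoeff [OF d, of f n] by (simp add: series_ring_def)
  have "lcoeff (x * z) = lcoeff 1"
    using f by (simp add: z series_ring_def lcoeff_mult lcoeff_1)
  hence "x * z = 1"
    by (simp add: lcoeff_inject)
  hence "z = y * x * z"
    using xy by (simp add: mult.commute)
  also have "\<dots> = y"
    using \<open>x * z = 1\<close> by (simp add: mult.assoc)
  finally show "f = lcoeff y"
    by (simp add: z)
qed

text \<open>
  A translated cone is moved into the cone by a monomial \<open>x\<^sup>w\<close> whose exponents are all equal to a
  large number \<open>K\<close>, since prefix sums do not decrease a nonnegative vector.
\<close>

lemma cone_laurent_quotient:
  fixes x :: "'k::field lseries"
  assumes n: "1 \<le> n" and d: "0 < d" and x: "x \<in> cone_laurent n d"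
  shows "\<exists>\<Gamma>\<in>cones n. lcoeff x \<in> quotient_field_in (laurent_field n d) (cone_series n \<Gamma> d)"
proof -
  obtain N c where c: "lsupp x \<subseteq> shifted_cone n d N c"
    using x by (auto simp: cone_laurent_def)
  obtain K where K: "c \<le> of_nat K"
    using real_arch_simple by blast
  define w where "w i = (if i < n then of_nat K else (0::rat))" for i
  have w: "w \<in> exponents n d"
    by (simp add: exponents_def w_def)
  have wN: "w i \<le> (prefix_sum ^^ N) w i" for i
    by (rule prefix_sum_pow_ge) (simp add: w_def)
  define g :: "'k lseries" where "g = lmonom w 1"
  define g' :: "'k lseries" where "g' = lmonom (- w) 1"
  have gg': "g * g' = 1"
    using lmonom_inverse [OF d w, of 1] by (simp add: g_def g'_def)
  have gK: "g \<in> cone_laurent n d" and g'K: "g' \<in> cone_laurent n d"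
    unfolding g_def g'_def using d w exponents_uminus [OF w] by (simp_all add: cone_laurent_lmonom)
  have cone: "lcoeff z \<in> cone_series n (prefix_sum_cone n N) d"
    if z: "z \<in> cone_laurent n d" "lsupp z \<subseteq> shifted_cone n d N 0" for z :: "'k lseries"
  proof -
    have "(\<lambda>i. of_rat (a i)) \<in> prefix_sum_cone n N" if "lcoeff z a \<noteq> 0" for a
    proof -
      have "a \<in> shifted_cone n d N 0"
        using z(2) that by (auto simp: lsupp_def)
      thus ?thesis
        by (simp add: prefix_sum_cone_def prefix_sum_pow_of_rat shifted_cone_def exponents_def)
    qed
    thus ?thesis
      using cone_laurent_iterated [OF z(1)] by (auto simp: cone_series_def newton_diagram_def)
  qed
  have "0 \<le> (prefix_sum ^^ N) w i" for i
    using wN [of i] by (simp add: w_def split: if_splits)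
  hence "w \<in> shifted_cone n d N 0"
    using w by (simp add: shifted_cone_def)
  hence g: "lcoeff g \<in> cone_series n (prefix_sum_cone n N) d"
    using gK by (intro cone) (auto simp: g_def lsupp_def lcoeff_lmonom [OF d w] split: if_splits)
  have "lsupp (g * x) \<subseteq> shifted_cone n d N 0"
  proof
    fix a assume "a \<in> lsupp (g * x)"
    hence "a - w \<in> lsupp x"
      by (simp only: lsupp_iff g_def lcoeff_lmonom_mult [OF d w] mult_1 not_False_eq_True)
    hence aw: "a - w \<in> shifted_cone n d N c"
      using c by blast
    have "0 \<le> (prefix_sum ^^ N) a i" if i: "i < n" for i
    proof -
      have "- c \<le> (prefix_sum ^^ N) (a - w) i"
        using aw i by (simp add: shifted_cone_def)
      also have "\<dots> = (prefix_sum ^^ N) a i - (prefix_sum ^^ N) w i"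
        by (simp add: prefix_sum_pow_diff)
      finally show ?thesis
        using wN [of i] K i by (simp add: w_def)
    qed
    moreover have "a \<in> exponents n d"
      using exponents_add [OF shifted_cone_exponents [OF aw] w] by simp
    ultimately show "a \<in> shifted_cone n d N 0"
      by (simp add: shifted_cone_def)
  qed
  hence f: "lcoeff (g * x) \<in> cone_series n (prefix_sum_cone n N) d"
    using cone_laurent_mult [OF gK x] by (intro cone)
  have "g \<noteq> 0"
    using gg' by auto
  hence "lcoeff g \<noteq> \<zero>\<^bsub>laurent_field n d\<^esub>"
    by (simp add: series_ring_def lcoeff_0 [symmetric] lcoeff_inject)
  moreover have "lcoeff x = lcoeff (g * x) \<otimes>\<^bsub>laurent_field n d\<^esub> inv\<^bsub>laurent_field n d\<^esub> (lcoeff g)"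
  proof -
    have "g * x * g' = x"
      using gg' by (simp add: mult_ac) (simp add: mult.assoc [symmetric])
    thus ?thesis
      by (simp only: laurent_field_inv [OF d g'K gg']) (simp add: series_ring_def lcoeff_mult [symmetric])
  qed
  ultimately have "lcoeff x \<in> quotient_field_in (laurent_field n d) (cone_series n (prefix_sum_cone n N) d)"
    unfolding quotient_field_in_def using f g by blast
  thus ?thesis
    using prefix_sum_cone_in_cones [OF n] by blast
qed

lemma quotient_cone_laurent:
  fixes h :: "(nat \<Rightarrow> rat) \<Rightarrow> 'k::field"
  assumes d: "0 < d" and \<Gamma>: "\<Gamma> \<in> cones n"
    and h: "h \<in> quotient_field_in (laurent_field n d) (cone_series n \<Gamma> d)"
  shows "\<exists>x\<in>cone_laurent n d. lcoeff x = h"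
proof -
  obtain f g where fg: "f \<in> cone_series n \<Gamma> d" "g \<in> cone_series n \<Gamma> d" "g \<noteq> \<zero>\<^bsub>laurent_field n d\<^esub>"
    "h = f \<otimes>\<^bsub>laurent_field n d\<^esub> inv\<^bsub>laurent_field n d\<^esub> g"
    using h by (auto simp: quotient_field_in_def)
  obtain x where x: "x \<in> cone_laurent n d" "lcoeff x = f"
    using cone_series_cone_laurent [OF d \<Gamma> fg(1)] by blast
  obtain y where y: "y \<in> cone_laurent n d" "lcoeff y = g"
    using cone_series_cone_laurent [OF d \<Gamma> fg(2)] by blast
  have "y \<noteq> 0"
    using fg(3) y(2) by (auto simp: series_ring_def lcoeff_0)
  then obtain z where z: "z \<in> cone_laurent n d" "y * z = 1"
    using cone_laurent_inverse [OF d y(1)] by blast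
  have "h = lcoeff (x * z)"
    using laurent_field_inv [OF d z] x(2) y(2) fg(4) by (simp add: series_ring_def lcoeff_mult)
  thus ?thesis
    using cone_laurent_mult [OF x(1) z(1)] by blast
qed

lemma cone_fraction_field_eq:
  assumes "1 \<le> n"
  shows "cone_fraction_field n = series_ring (lcoeff ` (cone_laurent_field n :: 'k::field lseries set))"
proof -
  have "(\<Union>\<Gamma>\<in>cones n. \<Union>d\<in>{0<..}. quotient_field_in (laurent_field n d) (cone_series n \<Gamma> d)) =
      lcoeff ` (cone_laurent_field n :: 'k lseries set)" (is "?L = ?R")
  proof (intro subset_antisym subsetI)
    fix h :: "(nat \<Rightarrow> rat) \<Rightarrow> 'k" assume "h \<in> ?L"
    then obtain \<Gamma> d where "\<Gamma> \<in> cones n" "0 < d"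
      "h \<in> quotient_field_in (laurent_field n d) (cone_series n \<Gamma> d)"
      by auto
    thus "h \<in> ?R"
      using quotient_cone_laurent [of d \<Gamma> n h] cone_laurent_fieldI by blast
  next
    fix h :: "(nat \<Rightarrow> rat) \<Rightarrow> 'k" assume "h \<in> ?R"
    then obtain x d where "h = lcoeff x" "0 < d" "x \<in> cone_laurent n d"
      by (auto simp: cone_laurent_field_def)
    thus "h \<in> ?L"
      using cone_laurent_quotient [OF assms, of d x] by auto
  qed
  thus ?thesis
    by (simp only: cone_fraction_field_def)
qed

section \<open>The field of fractions is algebraically closed\<close>

lemma series_ring_field:
  "field (series_ring (lcoeff ` (cone_laurent_field n :: 'k::field lseries set)))" (is "field ?F")
proof -
  let ?K = "cone_laurent_field n :: 'k lseries set"
  have car: "carrier ?F = lcoeff ` ?K"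
    by (simp add: series_ring_def)
  have ops: "lcoeff x \<oplus>\<^bsub>?F\<^esub> lcoeff y = lcoeff (x + y)" "lcoeff x \<otimes>\<^bsub>?F\<^esub> lcoeff y = lcoeff (x * y)"
    "\<zero>\<^bsub>?F\<^esub> = lcoeff 0" "\<one>\<^bsub>?F\<^esub> = lcoeff 1" for x y :: "'k lseries"
    by (simp_all add: series_ring_def lcoeff_add lcoeff_mult lcoeff_0 lcoeff_1)
  note closed = cone_laurent_field_0 cone_laurent_field_1 cone_laurent_field_add
    cone_laurent_field_mult cone_laurent_field_uminus
  have "abelian_group ?F"
  proof (rule abelian_groupI)
    fix f assume "f \<in> carrier ?F"
    then obtain x where x: "x \<in> ?K" "f = lcoeff x"
      by (auto simp: car)
    show "\<exists>g\<in>carrier ?F. g \<oplus>\<^bsub>?F\<^esub> f = \<zero>\<^bsub>?F\<^esub>"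
      unfolding car x(2) using cone_laurent_field_uminus [OF x(1)]
      by (intro bexI [of _ "lcoeff (- x)"]) (simp_all add: ops)
  qed (auto simp: car ops closed add_ac)
  moreover have "comm_monoid ?F"
    by (rule comm_monoidI) (auto simp: car ops closed mult_ac)
  ultimately have "cring ?F"
    by (rule cringI) (auto simp: car ops distrib_right)
  thus ?thesis
  proof (rule cring.cring_fieldI2)
    show "\<zero>\<^bsub>?F\<^esub> \<noteq> \<one>\<^bsub>?F\<^esub>"
      by (simp add: ops lcoeff_inject)
    fix f assume f: "f \<in> carrier ?F" "f \<noteq> \<zero>\<^bsub>?F\<^esub>"
    then obtain x where x: "x \<in> ?K" "f = lcoeff x" "x \<noteq> 0"
      by (auto simp: car ops)
    obtain y where y: "y \<in> ?K" "x * y = 1"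
      using cone_laurent_field_inverse [OF x(1,3)] by blast
    thus "\<exists>g\<in>carrier ?F. f \<otimes>\<^bsub>?F\<^esub> g = \<one>\<^bsub>?F\<^esub>"
      unfolding car x(2) by (intro bexI [of _ "lcoeff y"]) (simp_all add: ops)
  qed
qed

text \<open>
  The list reversal accounts for the two conventions: a polynomial given as a list over a ring starts
  with its leading coefficient, whereas \<^const>\<open>Poly\<close> expects the constant coefficient first.
\<close>

lemma series_ring_eval:
  fixes xs :: "'k::field lseries list" and n :: nat
  defines "F \<equiv> series_ring (lcoeff ` (cone_laurent_field n :: 'k lseries set))"
  shows "ring.eval F (map lcoeff xs) (lcoeff x) = lcoeff (poly (Poly (rev xs)) x)"
proof -
  interpret field F
    unfolding F_def by (rule series_ring_field)
  have ops: "lcoeff x \<oplus>\<^bsub>F\<^esub> lcoeff y = lcoeff (x + y)" "lcoeff x \<otimes>\<^bsub>F\<^esub> lcoeff y = lcoeff (x * y)"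
    "\<zero>\<^bsub>F\<^esub> = lcoeff 0" "\<one>\<^bsub>F\<^esub> = lcoeff 1" for x y :: "'k lseries"
    by (simp_all add: F_def series_ring_def lcoeff_add lcoeff_mult lcoeff_0 lcoeff_1)
  have pow: "lcoeff x [^]\<^bsub>F\<^esub> m = lcoeff (x ^ m)" for m :: nat
    by (induction m) (simp_all add: ops mult.commute)
  show ?thesis
    by (induction xs) (simp_all add: ops pow Poly_append poly_monom add.commute mult.commute)
qed

theorem theorem32:
  fixes n :: nat
  assumes "n > 1"
  shows "algebraically_closed
    (cone_fraction_field n :: ((nat \<Rightarrow> rat) \<Rightarrow> 'k::{alg_closed_field, field_char_0}) ring)"
proof -
  let ?K = "cone_laurent_field n :: 'k lseries set"
  define F where "F = series_ring (lcoeff ` ?K)"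
  interpret field F
    unfolding F_def by (rule series_ring_field)
  have car: "carrier F = lcoeff ` ?K"
    by (simp add: F_def series_ring_def)
  have "algebraically_closed F"
  proof (rule algebraically_closedI)
    fix p assume p: "p \<in> carrier (poly_ring F)" "length p - 1 > 1"
    have "set p \<subseteq> lcoeff ` ?K" "hd p \<noteq> \<zero>\<^bsub>F\<^esub>"
      using p unfolding univ_poly_carrier [symmetric] polynomial_def car by force+
    define xs where "xs = map (inv_into ?K lcoeff) p"
    have xs: "p = map lcoeff xs" "set xs \<subseteq> ?K"
      using \<open>set p \<subseteq> lcoeff ` ?K\<close>
      by (auto simp: xs_def map_idI f_inv_into_f subset_iff intro: inv_into_into)
    have len: "2 < length xs"
      using p(2) by (simp add: xs)
    have hd: "hd xs \<in> ?K" "hd xs \<noteq> 0"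
    proof -
      show "hd xs \<in> ?K"
        using xs(2) len by (metis hd_in_set list.size(3) not_less_zero subsetD)
      have "hd p = lcoeff (hd xs)"
        unfolding xs(1) using len by (intro list.map_sel(1)) auto
      thus "hd xs \<noteq> 0"
        using \<open>hd p \<noteq> \<zero>\<^bsub>F\<^esub>\<close> by (auto simp: F_def series_ring_def lcoeff_0)
    qed
    obtain j where j: "j \<in> ?K" "hd xs * j = 1"
      using cone_laurent_field_inverse [OF hd] by blast
    define m where "m = length xs - 1"
    define Q where "Q = Polynomial.smult j (Poly (rev xs))"
    have Q: "Polynomial.coeff Q i = (if i < length xs then j * xs ! (m - i) else 0)" for i
      by (simp add: Q_def coeff_Poly_eq nth_default_def rev_nth m_def)
    have Qm: "Polynomial.coeff Q m = 1"
    proof -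
      have "m < length xs" "xs ! 0 = hd xs"
        using len by (cases xs; simp add: m_def)+
      thus ?thesis
        using j(2) by (simp add: Q mult.commute)
    qed
    have deg: "Polynomial.degree Q = m"
    proof (rule antisym)
      show "Polynomial.degree Q \<le> m"
        by (rule degree_le) (auto simp: Q m_def)
      show "m \<le> Polynomial.degree Q"
        using Qm by (intro le_degree) simp
    qed
    have "\<exists>x\<in>?K. poly Q x = 0"
    proof (rule monic_has_root)
      show "Polynomial.coeff Q i \<in> ?K" for i
        using xs(2) j(1) by (auto simp: Q m_def cone_laurent_field_0 intro!: cone_laurent_field_mult)
    qed (use len deg Qm in \<open>auto simp: m_def\<close>)
    then obtain x where x: "x \<in> ?K" "poly Q x = 0"
      by blast
    have "poly (Poly (rev xs)) x = hd xs * j * poly (Poly (rev xs)) x"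
      using j(2) by simp
    also have "\<dots> = hd xs * poly Q x"
      by (simp add: Q_def mult.assoc)
    finally have "poly (Poly (rev xs)) x = 0"
      using x(2) by simp
    hence "eval p (lcoeff x) = \<zero>\<^bsub>F\<^esub>"
      unfolding xs(1) F_def series_ring_eval by (simp add: series_ring_def lcoeff_0)
    thus "\<exists>x\<in>carrier F. eval p x = \<zero>\<^bsub>F\<^esub>"
      using x(1) unfolding car by blast
  qed
  thus ?thesis
    using assms cone_fraction_field_eq [of n, where 'k = 'k] by (simp add: F_def)
qed

end
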